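(* Let $\lambda = \frac{\log 2}{\log \varphi}$ where $\varphi = \frac{1+\sqrt5}{2}$, and define \[ c_1 = \liminf_{H \to \infty} \frac{A(H)}{H^{\lambda}}, \qquad c_2 = \limsup_{H \to \infty} \frac{A(H)}{H^{\lambda}}. \] Then \[ 0.525347 < c_1 < 0.525349, \qquad 0.5433878 < c_2 < 0.5433893. \] In particular $c_1 = 0.52534\ldots$ and $c_2 = 0.54338\ldots$.
   Context: The Fibonacci numbers are $F_1 = F_2 = 1$, $F_{m+1} = F_m + F_{m-1}$. For $n \in \mathbb{Z}_{\ge 0}$, $R(n)$ is the number of solutions to $x_1 + \cdots + x_s = n$ with $s \in \mathbb{Z}_{\ge 0}$ and $x_1 < \cdots < x_s$ Fibonacci numbers (partitions of $n$ into distinct Fibonacci numbers; $R(0)=1$). For $H \in \mathbb{Z}$, $A(H) = \sum_{n=0}^{H} R(n)$. *)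

theory Defs
  imports Complex_Main "HOL-Library.Extended_Real" "HOL-Library.Liminf_Limsup" "HOL-Number_Theory.Fib"
begin

definition golden_ratio :: real where
  "golden_ratio = (1 + sqrt 5) / 2"

(* The image of fib over indices >= 1 is a set of values, so F_1 = F_2 = 1 provides a single part. *)
definition fibonacci_numbers :: "nat set" where
  "fibonacci_numbers = fib ` {1..}"

definition fib_partitions :: "nat \<Rightarrow> nat list set" where
  "fib_partitions n =
     {xs. sorted_wrt (<) xs \<and> set xs \<subseteq> fibonacci_numbers \<and> sum_list xs = n}"

definition R :: "nat \<Rightarrow> nat" where
  "R n = card (fib_partitions n)"

definition A :: "int \<Rightarrow> nat" where
  "A H = (\<Sum>n\<in>{0..H}. R (nat n))"

definition fib_exponent :: real where
  "fib_exponent = ln 2 / ln golden_ratio"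

end

theory Submission
  imports Defs "HOL-Library.FuncSet"
begin

text \<open>
  With \<open>\<phi>\<close> the golden ratio, \<open>A(x \<phi>\<^sup>m\<^sup>+\<^sup>2 / \<surd>5) / 2\<^sup>m\<close> converges to a monotone function \<open>G\<close> on
  \<open>[0, \<phi>]\<close>.  Deciding whether the largest possible part is used, and complementing the set of the
  remaining parts if it is not, gives \<open>G(\<phi> x) = 2 G(x)\<close> and
  \<open>G(x) = 1 + G(x - 1) - G(\<phi> - x)\<close> for \<open>1 \<le> x \<le> \<phi>\<close>; hence \<open>G\<close> has explicit rational values on a dense
  subset of \<open>\<int>[\<phi>]\<close>.  The limits inferior and superior are the extrema over \<open>[1, \<phi>]\<close> of \<open>G(x) / (4 (x/\<surd>5)\<^sup>\<lambda>)\<close>.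
  On an interval \<open>[u, v]\<close> this quotient lies between \<open>G(u) / (4 (v/\<surd>5)\<^sup>\<lambda>)\<close> and \<open>G(v) / (4 (u/\<surd>5)\<^sup>\<lambda>)\<close>, so
  a few hundred intervals suffice for the bounds, and two well-chosen points give the opposite bounds.
  Powers \<open>y\<^sup>\<lambda>\<close> are bounded without logarithms: \<open>\<phi>\<^sup>\<lambda> = 2\<close> gives \<open>y\<^sup>\<lambda> = 2\<^sup>j\<^sup>/\<^sup>N\<close> for \<open>y = \<phi>\<^sup>j\<^sup>/\<^sup>N\<close>, and
  \<open>u\<^sup>2 / (1 + (2 - \<lambda>)(u - 1)) \<le> u\<^sup>\<lambda> \<le> u (1 + (\<lambda> - 1)(u - 1))\<close> handles ratios \<open>u\<close> near \<open>1\<close>.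
\<close>

section \<open>Counting partitions into distinct Fibonacci numbers\<close>

text \<open>The shift by two drops the repeated value 1, so that \<open>F\<close> lists the
  admissible parts injectively and in increasing order.\<close>

definition F :: "nat \<Rightarrow> nat" where
  "F m = fib (m + 2)"

lemma F_0 [simp]: "F 0 = 1"
  by (simp add: F_def)

lemma F_1 [simp]: "F (Suc 0) = 2"
  by (simp add: F_def)

lemma F_Suc_Suc [simp]: "F (Suc (Suc m)) = F (Suc m) + F m"
  by (simp add: F_def)

lemma F_pos [simp]: "0 < F m"
  by (simp add: F_def fib_neq_0_nat)

lemma strict_mono_F: "strict_mono F"
proof (rule strict_mono_Suc_iff[THEN iffD2], rule allI)
  fix m show "F m < F (Suc m)" by (cases m) auto
qed

lemma F_less_iff [simp]: "F k < F m \<longleftrightarrow> k < m"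
  by (rule strict_mono_less[OF strict_mono_F])

lemma fibonacci_numbers_eq_range: "fibonacci_numbers = range F"
proof -
  have "{1::nat..} = insert 1 ((\<lambda>m. m + 2) ` UNIV)"
  proof (intro equalityI subsetI)
    fix k :: nat assume "k \<in> {1..}"
    then have "k = 1 \<or> k = (k - 2) + 2" by auto
    then show "k \<in> insert 1 ((\<lambda>m. m + 2) ` UNIV)" by blast
  qed auto
  then have "fibonacci_numbers = insert (fib 1) ((\<lambda>m. fib (m + 2)) ` UNIV)"
    unfolding fibonacci_numbers_def by (simp only: image_insert image_image)
  also have "\<dots> = range F"
    using rangeI[of F 0] unfolding F_def by (simp add: insert_absorb)
  finally show ?thesis .
qed

text \<open>Splits on whether the largest of the first \<open>m\<close> parts is used. The bound is
  an integer so that overdrawn bounds, being negative, simply count nothing.\<close>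

fun bounded_count :: "nat \<Rightarrow> int \<Rightarrow> nat" where
  "bounded_count 0 h = (if 0 \<le> h then 1 else 0)"
| "bounded_count (Suc m) h = bounded_count m h + bounded_count m (h - int (F m))"

lemma card_Pow_insert_Collect:
  assumes "finite B" "x \<notin> B"
  shows "card {S \<in> Pow (insert x B). P S} = card {S \<in> Pow B. P S} + card {S \<in> Pow B. P (insert x S)}"
proof -
  have eq: "{S \<in> Pow (insert x B). P S} = {S \<in> Pow B. P S} \<union> insert x ` {S \<in> Pow B. P (insert x S)}"
    by (auto simp: Pow_insert)
  have inj: "inj_on (insert x) {S \<in> Pow B. P (insert x S)}"
  proof (rule inj_onI)
    fix S T assume "S \<in> {S \<in> Pow B. P (insert x S)}" "T \<in> {S \<in> Pow B. P (insert x S)}"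
      and "insert x S = insert x T"
    then show "S = T" using assms(2) insert_ident[of x S T] by blast
  qed
  have fin: "finite (Pow B)" using assms(1) by simp
  show ?thesis
    unfolding eq
    by (subst card_Un_disjoint) (use assms fin inj in \<open>auto simp: card_image\<close>)
qed

lemma bounded_count_eq_card:
  "bounded_count m h = card {S \<in> Pow (F ` {..<m}). int (\<Sum>S) \<le> h}"
proof (induction m arbitrary: h)
  case 0
  have "{S \<in> Pow ({} :: nat set). int (\<Sum>S) \<le> h} = (if 0 \<le> h then {{}} else {})"
    by auto
  then show ?case by simp
next
  case (Suc m)
  let ?F = "F ` {..<m}"
  have new: "F m \<notin> ?F"
    using strict_mono_eq[OF strict_mono_F] by auto
  have sum: "\<Sum>(insert (F m) S) = F m + \<Sum>S" if "S \<in> Pow ?F" for S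
  proof (rule sum.insert)
    show "finite S" using that finite_subset[of S ?F] by simp
    show "F m \<notin> S" using that new by blast
  qed
  have ins: "F ` {..<Suc m} = insert (F m) ?F"
    by (auto simp: less_Suc_eq)
  have "{S \<in> Pow ?F. int (\<Sum>(insert (F m) S)) \<le> h} = {S \<in> Pow ?F. int (\<Sum>S) \<le> h - int (F m)}"
    by (intro Collect_cong conj_cong refl) (simp add: sum algebra_simps)
  then show ?case
    unfolding ins by (subst card_Pow_insert_Collect) (use new in \<open>auto simp: Suc.IH\<close>)
qed

text \<open>A strictly increasing list is determined by its set of entries, so partitions may be
  treated as finite sets.\<close>

lemma R_eq_card:
  "R n = card {S. finite S \<and> S \<subseteq> fibonacci_numbers \<and> \<Sum>S = n}"
proof -
  have "bij_betw set (fib_partitions n) {S. finite S \<and> S \<subseteq> fibonacci_numbers \<and> \<Sum>S = n}"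
    unfolding fib_partitions_def
    by (rule bij_betwI[where g = sorted_list_of_set])
      (auto simp: strict_sorted_iff sorted_list_of_set.idem_if_sorted_distinct
        sum_list_distinct_conv_sum_set[of _ "\<lambda>x. x", simplified])
  then show ?thesis
    unfolding R_def by (rule bij_betw_same_card)
qed

text \<open>A set with sum at most \<open>h < F m\<close> has all its parts below
  \<open>F m\<close>. Grouping these sets by their exact sum gives the terms of
  \<open>A h\<close>.\<close>

lemma A_eq_bounded_count:
  assumes "h < int (F m)"
  shows "A h = bounded_count m h"
proof -
  let ?F = "F ` {..<m}"
  have R: "R (nat n) = card {S \<in> Pow ?F. int (\<Sum>S) = n}" if n: "n \<in> {0..h}" for n
  proof -
    have sub: "S \<subseteq> ?F" if S: "finite S" "S \<subseteq> fibonacci_numbers" "\<Sum>S = nat n" for S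
    proof
      fix x assume x: "x \<in> S"
      then have "x \<le> \<Sum>S" using S(1) by (intro member_le_sum) auto
      also have "\<dots> < F m" using S(3) n assms by auto
      finally show "x \<in> ?F"
        using x S(2) by (auto simp: fibonacci_numbers_eq_range)
    qed
    have fin: "finite S \<and> S \<subseteq> fibonacci_numbers" if "S \<subseteq> ?F" for S
      using that finite_subset[of S ?F] by (auto simp: fibonacci_numbers_eq_range)
    have "{S. finite S \<and> S \<subseteq> fibonacci_numbers \<and> \<Sum>S = nat n} = {S \<in> Pow ?F. \<Sum>S = nat n}"
      using sub fin by (intro Collect_cong) (meson PowI PowD)
    also have "\<dots> = {S \<in> Pow ?F. int (\<Sum>S) = n}"
      using n by (intro Collect_cong conj_cong refl) (auto simp del: of_nat_sum)
    finally show ?thesis by (simp add: R_eq_card)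
  qed
  have "A h = (\<Sum>n\<in>{0..h}. card {S \<in> Pow ?F. int (\<Sum>S) = n})"
    unfolding A_def by (intro sum.cong refl R)
  also have "\<dots> = card (\<Union>n\<in>{0..h}. {S \<in> Pow ?F. int (\<Sum>S) = n})"
    by (subst card_UN_disjoint) auto
  also have "(\<Union>n\<in>{0..h}. {S \<in> Pow ?F. int (\<Sum>S) = n}) = {S \<in> Pow ?F. int (\<Sum>S) \<le> h}"
    by (auto simp del: of_nat_sum)
  finally show ?thesis by (simp add: bounded_count_eq_card)
qed

section \<open>Reflection, increments and the recurrence for the summatory function\<close>

lemma bounded_count_neg: "h < 0 \<Longrightarrow> bounded_count m h = 0"
  by (induction m arbitrary: h) auto

text \<open>Complementation in \<^term>\<open>F ` {..<m}\<close>, whose sum is \<^term>\<open>int (F (Suc m)) - 2\<close>.\<close>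

lemma bounded_count_reflect:
  "bounded_count m h + bounded_count m (int (F (Suc m)) - 3 - h) = 2 ^ m"
proof (induction m arbitrary: h)
  case (Suc m)
  have eq: "int (F (Suc (Suc m))) - 3 - h = int (F (Suc m)) - 3 - (h - int (F m))"
    "int (F (Suc m)) - 3 - (h - int (F m)) - int (F m) = int (F (Suc m)) - 3 - h"
    by simp_all
  show ?case
    using Suc.IH[of h] Suc.IH[of "h - int (F m)"]
    unfolding bounded_count.simps eq power_Suc by linarith
qed auto

lemma bounded_count_top: "int (F (Suc m)) - 2 \<le> h \<Longrightarrow> bounded_count m h = 2 ^ m"
  using bounded_count_reflect[of m h] by (simp add: bounded_count_neg)

lemma bounded_count_le: "bounded_count m h \<le> 2 ^ m"
  using bounded_count_reflect[of m h] by linarith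

text \<open>The increment \<open>d n\<close> counts subsets with sum exactly \<open>n\<close>.
  Adding two parts turns it into four increments, but \<open>d\<close> vanishes outside
  \<open>[0, g - 2]\<close>, so of two increments at distance \<open>g\<close> at most one is
  nonzero. Hence two parts only double the bound, which is negligible against
  \<open>2 ^ m\<close>.\<close>

lemma bounded_count_step:
  "bounded_count m (n - 1) \<le> bounded_count m n \<and>
   bounded_count m n \<le> bounded_count m (n - 1) + 2 ^ (m div 2)"
proof (induction m arbitrary: n rule: induct_nat_012)
  case (ge2 m)
  define f where "f = int (F m)"
  define g where "g = int (F (Suc m))"
  let ?B = "bounded_count m" and ?C = "bounded_count (Suc (Suc m))"
  define d where "d n = int (?B n) - int (?B (n - 1))" for n
  have B: "?C n = ?B n + ?B (n - f) + (?B (n - g) + ?B (n - g - f))" for n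
    by (simp add: f_def g_def)
  have d: "0 \<le> d n" "d n \<le> 2 ^ (m div 2)" for n
  proof -
    have "int (?B (n - 1)) \<le> int (?B n) \<and> int (?B n) \<le> int (?B (n - 1) + 2 ^ (m div 2))"
      using ge2.IH(1)[of n] unfolding of_nat_le_iff .
    then show "0 \<le> d n" "d n \<le> 2 ^ (m div 2)" by (simp_all add: d_def)
  qed
  have d_neg: "d n = 0" if "n < 0" for n
    using that by (simp add: d_def bounded_count_neg)
  have d_top: "d n = 0" if "g - 2 < n" for n
    using that by (simp add: d_def bounded_count_top g_def)
  have eq: "int (?C n) - int (?C (n - 1)) = (d n + d (n - g)) + (d (n - f) + d (n - g - f))"
    unfolding B d_def by (simp add: algebra_simps)
  have pair: "d k + d (k - g) \<le> 2 ^ (m div 2)" for k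
    using d(2)[of k] d(2)[of "k - g"] d_neg[of "k - g"] d_top[of k] by (cases "k < g") auto
  have "d (n - f) + d (n - g - f) \<le> 2 ^ (m div 2)"
    using pair[of "n - f"] by (simp add: algebra_simps)
  then have "int (?C n) - int (?C (n - 1)) \<le> 2 * 2 ^ (m div 2)"
    unfolding eq using pair[of n] by linarith
  moreover have "0 \<le> int (?C n) - int (?C (n - 1))"
    unfolding eq using d(1) by (intro add_nonneg_nonneg)
  ultimately have "int (?C n) \<le> int (?C (n - 1) + 2 * 2 ^ (m div 2))" "int (?C (n - 1)) \<le> int (?C n)"
    by simp_all
  then show ?case unfolding of_nat_le_iff by simp
qed auto

lemma bounded_count_lipschitz:
  assumes "h \<le> h'"
  shows "real (bounded_count m h) \<le> real (bounded_count m h')"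
    and "real (bounded_count m h') \<le> real (bounded_count m h) + of_int (h' - h) * 2 ^ (m div 2)"
proof -
  have "real (bounded_count m h) \<le> real (bounded_count m h') \<and> 
        real (bounded_count m h') \<le> real (bounded_count m h) + of_int (h' - h) * 2 ^ (m div 2)"
    using assms
  proof (induction h' rule: int_ge_induct)
    case (step i)
    have "real (bounded_count m (i + 1)) \<le> real (bounded_count m i + 2 ^ (m div 2))"
      "real (bounded_count m i) \<le> real (bounded_count m (i + 1))"
      using bounded_count_step[of m "i + 1"] unfolding of_nat_le_iff by simp_all
    with step.IH show ?case by (simp add: algebra_simps)
  qed simp
  then show "real (bounded_count m h) \<le> real (bounded_count m h')"
    "real (bounded_count m h') \<le> real (bounded_count m h) + of_int (h' - h) * 2 ^ (m div 2)"
    by auto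
qed

lemma A_mono: "h \<le> h' \<Longrightarrow> A h \<le> A h'"
  unfolding A_def by (intro sum_mono2) auto

lemma A_lipschitz:
  assumes "h < int (F m)" "h' < int (F m)"
  shows "\<bar>real (A h) - real (A h')\<bar> \<le> of_int \<bar>h - h'\<bar> * 2 ^ (m div 2)"
  using bounded_count_lipschitz[of h h' m] bounded_count_lipschitz[of h' h m]
  by (cases "h \<le> h'") (simp_all add: A_eq_bounded_count[OF assms(1)] A_eq_bounded_count[OF assms(2)])

lemma A_le_power: "h < int (F m) \<Longrightarrow> A h \<le> 2 ^ m"
  by (simp add: A_eq_bounded_count bounded_count_le)

lemma A_recurrence:
  assumes "int (F m) \<le> h" "h < int (F (Suc m))"
  shows "real (A h) = 2 ^ m + real (A (h - int (F m))) - real (A (int (F (Suc m)) - 3 - h))"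
proof -
  \<comment> \<open>This keeps both reduced arguments below \<open>F m\<close>, where
    \<open>bounded_count m\<close> still equals \<open>A\<close>.\<close>
  have "F (Suc m) \<le> 2 * F m" using F_less_iff[of "m - 1" m] by (cases m) (auto simp del: F_less_iff)
  then have "A h = bounded_count (Suc m) h" 
    "A (h - int (F m)) = bounded_count m (h - int (F m))"
    "A (int (F (Suc m)) - 3 - h) = bounded_count m (int (F (Suc m)) - 3 - h)"
    using assms by (auto intro!: A_eq_bounded_count simp del: bounded_count.simps)
  moreover have "real (bounded_count m h) + real (bounded_count m (int (F (Suc m)) - 3 - h)) = 2 ^ m"
    using bounded_count_reflect[of m h] by (metis of_nat_add of_nat_numeral of_nat_power)
  ultimately show ?thesis by simp
qed

section \<open>The limit function\<close>

abbreviation phi :: real ("\<phi>") where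
  "\<phi> \<equiv> golden_ratio"

section \<open>Golden ratio arithmetic and the scaled counts\<close>

lemma phi_square: "\<phi>\<^sup>2 = \<phi> + 1"
  by (simp add: golden_ratio_def power2_eq_square field_simps)

lemma phi_mult_self: "\<phi> * \<phi> = \<phi> + 1"
  using phi_square by (simp add: power2_eq_square)

lemma phi_bounds: "3/2 < \<phi>" "\<phi> < 2"
proof -
  have "2 < sqrt 5" "sqrt 5 < 3"
    by (auto intro: real_less_rsqrt real_less_lsqrt)
  then show "3/2 < \<phi>" "\<phi> < 2" by (auto simp: golden_ratio_def)
qed

lemma phi_pos [simp]: "0 < \<phi>" "0 \<le> \<phi>" "\<phi> \<noteq> 0" "1 < \<phi>" "1 \<le> \<phi>"
  using phi_bounds by auto

text \<open>The dominant term of Binet's formula for \<open>F m\<close>.\<close>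

definition \<theta> :: "nat \<Rightarrow> real" where
  "\<theta> m = \<phi> ^ (m + 2) / sqrt 5"

lemma theta_pos [simp]: "0 < \<theta> m"
  by (simp add: \<theta>_def)

lemma theta_neq_0 [simp]: "\<theta> m \<noteq> 0"
  by (simp add: \<theta>_def)

lemma theta_Suc: "\<theta> (Suc m) = \<phi> * \<theta> m"
  by (simp add: \<theta>_def)

lemma F_theta: "\<bar>real (F m) - \<theta> m\<bar> \<le> 1"
proof -
  have "int (F m) = round (\<theta> m)"
    using fib_closed_form'[of "m + 2"] unfolding F_def \<theta>_def golden_ratio_def by simp
  then have "real (F m) = of_int (round (\<theta> m))"
    by (metis of_int_of_nat_eq)
  then show ?thesis
    using of_int_round_abs_le[of "\<theta> m"] by simp
qed

definition scaled_count :: "nat \<Rightarrow> real \<Rightarrow> real" where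
  "scaled_count m x = real (A \<lfloor>x * \<theta> m\<rfloor>) / 2 ^ m"

text \<open>Raising the level is the same as stretching the argument; this exact self-similarity
  becomes \<open>G_scale\<close> in the limit.\<close>

lemma scaled_count_Suc: "scaled_count (Suc m) x = scaled_count m (\<phi> * x) / 2"
  by (simp add: scaled_count_def theta_Suc mult_ac)

lemma scaled_count_nonneg: "0 \<le> scaled_count m x"
  by (simp add: scaled_count_def)

lemma scaled_count_mono: "x \<le> y \<Longrightarrow> scaled_count m x \<le> scaled_count m y"
  unfolding scaled_count_def
  by (intro divide_right_mono of_nat_mono A_mono floor_mono mult_right_mono)
    (auto simp: less_imp_le)

lemma floor_less_F:
  assumes "x \<le> \<phi>"
  shows "\<lfloor>x * \<theta> m\<rfloor> < int (F (m + 3))"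
proof -
  have "x * \<theta> m \<le> \<theta> (Suc m)"
    using assms by (simp add: theta_Suc mult_right_mono less_imp_le)
  also have "\<dots> \<le> real (F (Suc m)) + 1"
    using F_theta[of "Suc m"] by linarith
  also have "\<dots> < real (F (m + 3))"
    using F_pos[of m] F_pos[of "Suc m"] by (simp add: eval_nat_numeral del: F_pos)
  finally show ?thesis by (simp add: floor_less_iff)
qed

lemma scaled_count_le: "x \<le> \<phi> \<Longrightarrow> scaled_count m x \<le> 8"
proof -
  assume "x \<le> \<phi>"
  then have "real (A \<lfloor>x * \<theta> m\<rfloor>) \<le> real (2 ^ (m + 3))"
    by (intro of_nat_mono A_le_power floor_less_F)
  then show ?thesis
    unfolding scaled_count_def of_nat_power of_nat_numeral power_add by (simp add: field_simps)
qed

text \<open>The factor 15 is 2 + 5 + 8, the rounding shifts of the three arguments in the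
  recurrence; the offset 3 comes from \<open>floor_less_F\<close>, which puts all of them below
  \<open>F (m + 3)\<close>.\<close>

definition rec_error :: "nat \<Rightarrow> real" where
  "rec_error m = 15 * 2 ^ ((m + 3) div 2) / 2 ^ m"

lemma rec_error_tendsto: "rec_error \<longlonglongrightarrow> 0"
proof (rule tendsto_sandwich[OF always_eventually always_eventually])
  show "\<forall>m. 0 \<le> rec_error m" by (simp add: rec_error_def)
  show "\<forall>m. rec_error m \<le> 60 * (sqrt 2 / 2) ^ m"
  proof
    fix m
    \<comment> \<open>Squaring avoids half-integer exponents and a case split on parity.\<close>
    have "(2 ^ ((m + 3) div 2))\<^sup>2 \<le> (2::real) ^ (m + 3)"
      unfolding power_mult[symmetric] by (intro power_increasing) auto
    also have "\<dots> \<le> (4 * sqrt 2 ^ m)\<^sup>2"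
      by (simp add: power_add power_mult_distrib flip: power_mult) (simp add: power_mult mult.commute[of _ 2])
    finally have "2 ^ ((m + 3) div 2) \<le> 4 * sqrt 2 ^ m"
      by (rule power2_le_imp_le) simp
    then show "rec_error m \<le> 60 * (sqrt 2 / 2) ^ m"
      by (simp add: rec_error_def power_divide field_simps)
  qed
  have "sqrt 2 < 2" by (auto intro: real_less_lsqrt)
  then show "(\<lambda>m. 60 * (sqrt 2 / 2) ^ m) \<longlonglongrightarrow> 0"
    by (intro tendsto_mult_right_zero LIMSEQ_power_zero) auto
qed simp

text \<open>\<open>A_recurrence\<close> holds exactly at integers. Passing to floors of multiples of
  \<open>\<theta> m\<close> moves each argument by a bounded amount, and \<open>A_lipschitz\<close>
  turns these shifts into the error.\<close>

lemma scaled_count_recurrence: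
  assumes "1 \<le> x" "x \<le> \<phi>"
  shows "\<bar>scaled_count m x - (1 + scaled_count m (x - 1) - scaled_count m (\<phi> - x))\<bar> \<le> rec_error m"
proof -
  define h0 where "h0 = \<lfloor>x * \<theta> m\<rfloor>"
  \<comment> \<open>As \<open>F\<close> and \<open>\<theta>\<close> differ by up to 1,
    \<open>h0\<close> may leave the range of \<open>A_recurrence\<close>; clamping it moves it by at
    most 2.\<close>
  define h where "h = max (int (F m)) (min h0 (int (F (Suc m)) - 1))"
  define h1 where "h1 = \<lfloor>(x - 1) * \<theta> m\<rfloor>"
  define h2 where "h2 = \<lfloor>(\<phi> - x) * \<theta> m\<rfloor>"
  let ?M = "m + 3"
  have Fm: "F m < F (Suc m)" by simp
  have h: "int (F m) \<le> h" "h < int (F (Suc m))"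
    using Fm by (auto simp: h_def simp del: F_less_iff)
  have x\<theta>: "\<theta> m \<le> x * \<theta> m" "x * \<theta> m \<le> \<theta> (Suc m)"
    using assms by (auto simp: theta_Suc)
  have e: "\<bar>real (F m) - \<theta> m\<bar> \<le> 1" "\<bar>real (F (Suc m)) - \<theta> (Suc m)\<bar> \<le> 1"
    by (rule F_theta)+
  have h0: "real_of_int h0 \<le> x * \<theta> m" "x * \<theta> m < real_of_int h0 + 1"
    unfolding h0_def by linarith+
  have h1: "real_of_int h1 \<le> x * \<theta> m - \<theta> m" "x * \<theta> m - \<theta> m < real_of_int h1 + 1"
    unfolding h1_def left_diff_distrib by linarith+
  have h2: "real_of_int h2 \<le> \<theta> (Suc m) - x * \<theta> m" "\<theta> (Suc m) - x * \<theta> m < real_of_int h2 + 1"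
    unfolding h2_def left_diff_distrib theta_Suc by linarith+
  have "real_of_int h0 > real_of_int (int (F m) - 2)" "real_of_int h0 \<le> real_of_int (int (F (Suc m)) + 1)"
    using h0 x\<theta> e unfolding of_int_diff of_int_add of_int_of_nat_eq of_int_numeral of_int_1
    by linarith+
  then have h0_near: "int (F m) - 1 \<le> h0" "h0 \<le> int (F (Suc m)) + 1"
    unfolding of_int_less_iff of_int_le_iff by auto
  have d0: "\<bar>h0 - h\<bar> \<le> 2"
    using h0_near Fm by (auto simp: h_def simp del: F_less_iff)
  then have d0': "\<bar>real_of_int h0 - real_of_int h\<bar> \<le> 2" by linarith
  have "\<bar>real_of_int (h1 - (h - int (F m)))\<bar> \<le> real_of_int 5"
    using h0 h1 d0' e by simp
  then have d1: "\<bar>h1 - (h - int (F m))\<bar> \<le> 5"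
    by linarith
  have "\<bar>real_of_int (h2 - (int (F (Suc m)) - 3 - h))\<bar> \<le> real_of_int 8"
    using h0 h2 d0' e by simp
  then have d2: "\<bar>h2 - (int (F (Suc m)) - 3 - h)\<bar> \<le> 8"
    by linarith
  have F3: "F (Suc m) < F ?M" by simp
  have lip: "\<bar>real (A k) - real (A l)\<bar> \<le> of_int c * 2 ^ (?M div 2)"
    if "k < int (F ?M)" "l < int (F ?M)" "\<bar>k - l\<bar> \<le> c" for k l c
  proof -
    have "\<bar>real (A k) - real (A l)\<bar> \<le> of_int \<bar>k - l\<bar> * 2 ^ (?M div 2)"
      using that(1,2) by (rule A_lipschitz)
    also have "\<dots> \<le> of_int c * 2 ^ (?M div 2)"
      using that(3) by (intro mult_right_mono) auto
    finally show ?thesis .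
  qed
  have l0: "\<bar>real (A h0) - real (A h)\<bar> \<le> of_int 2 * 2 ^ (?M div 2)"
    using floor_less_F[OF assms(2), of m] h F3 d0 by (intro lip) (auto simp: h0_def simp del: F_less_iff)
  have l1: "\<bar>real (A h1) - real (A (h - int (F m)))\<bar> \<le> of_int 5 * 2 ^ (?M div 2)"
    using floor_less_F[of "x - 1" m] assms h F3 d1 by (intro lip) (auto simp: h1_def simp del: F_less_iff)
  have l2: "\<bar>real (A h2) - real (A (int (F (Suc m)) - 3 - h))\<bar> \<le> of_int 8 * 2 ^ (?M div 2)"
    using floor_less_F[of "\<phi> - x" m] assms h F3 d2 by (intro lip) (auto simp: h2_def simp del: F_less_iff)
  have "\<bar>real (A h0) - (2 ^ m + real (A h1) - real (A h2))\<bar> \<le> 15 * 2 ^ (?M div 2)"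
    using l0 l1 l2 A_recurrence[OF h] by (simp add: abs_le_iff)
  then have "\<bar>real (A h0) - (2 ^ m + real (A h1) - real (A h2))\<bar> / 2 ^ m \<le> rec_error m"
    unfolding rec_error_def by (intro divide_right_mono) auto
  also have "\<bar>real (A h0) - (2 ^ m + real (A h1) - real (A h2))\<bar> / 2 ^ m =
    \<bar>(real (A h0) - (2 ^ m + real (A h1) - real (A h2))) / 2 ^ m\<bar>"
    by (simp add: abs_divide)
  also have "(real (A h0) - (2 ^ m + real (A h1) - real (A h2))) / 2 ^ m =
    scaled_count m x - (1 + scaled_count m (x - 1) - scaled_count m (\<phi> - x))"
    unfolding scaled_count_def h0_def[symmetric] h1_def[symmetric] h2_def[symmetric]
    by (simp add: field_simps)
  finally show ?thesis .
qed

section \<open>Convergence by contraction of the asymptotic oscillation\<close>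

definition osc_le :: "real \<Rightarrow> real \<Rightarrow> bool" where
  "osc_le x e \<longleftrightarrow> (\<exists>N. \<forall>m\<ge>N. \<forall>n\<ge>N. \<bar>scaled_count m x - scaled_count n x\<bar> \<le> e)"

lemma osc_le_mono: "osc_le x e \<Longrightarrow> e \<le> e' \<Longrightarrow> osc_le x e'"
  unfolding osc_le_def by (meson order_trans)

lemma osc_le_scale: 
  assumes "osc_le (\<phi> * x) e"
  shows "osc_le x (e / 2)"
proof -
  obtain N where N: "\<bar>scaled_count m (\<phi> * x) - scaled_count n (\<phi> * x)\<bar> \<le> e" if "m \<ge> N" "n \<ge> N" for m n
    using assms unfolding osc_le_def by blast
  show ?thesis
    unfolding osc_le_def
  proof (intro exI[of _ "Suc N"] allI impI)
    fix m n assume "m \<ge> Suc N" "n \<ge> Suc N"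
    then obtain m' n' where "m = Suc m'" "n = Suc n'" "m' \<ge> N" "n' \<ge> N"
      by (intro that[of "m - 1" "n - 1"]) auto
    then show "\<bar>scaled_count m x - scaled_count n x\<bar> \<le> e / 2"
      using N[of m' n'] by (simp add: scaled_count_Suc flip: diff_divide_distrib)
  qed
qed

text \<open>Both arguments on the right-hand side of the recurrence lie in \<open>[0, 1/\<phi>]\<close>, where the
  scaling by \<open>\<phi>\<^sup>2\<close> divides oscillations by four.\<close>

lemma osc_le_contract:
  assumes osc: "\<And>x. 0 \<le> x \<Longrightarrow> x \<le> \<phi> \<Longrightarrow> osc_le x e" and e: "0 < e" and x: "0 \<le> x" "x \<le> \<phi>"
  shows "osc_le x (3/4 * e)"
proof -
  have small: "osc_le y (e / 4)" if "0 \<le> y" "y \<le> \<phi> - 1" for y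
  proof -
    have "\<phi> * (\<phi> * y) \<le> \<phi> * (\<phi> * (\<phi> - 1))"
      using that by (intro mult_left_mono) auto
    also have "\<dots> = \<phi>"
      using phi_mult_self by (simp add: algebra_simps)
    finally have "osc_le (\<phi> * y) (e / 2)"
      using that by (intro osc_le_scale osc) auto
    then have "osc_le y (e / 2 / 2)" by (rule osc_le_scale)
    then show ?thesis by simp
  qed
  have large: "osc_le y (3/4 * e)" if y: "1 \<le> y" "y \<le> \<phi>" for y
  proof -
    obtain N1 where N1: "\<bar>scaled_count m (y - 1) - scaled_count n (y - 1)\<bar> \<le> e / 4" if "m \<ge> N1" "n \<ge> N1" for m n
      using small[of "y - 1"] y unfolding osc_le_def by auto
    obtain N2 where N2: "\<bar>scaled_count m (\<phi> - y) - scaled_count n (\<phi> - y)\<bar> \<le> e / 4" if "m \<ge> N2" "n \<ge> N2" for m n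
      using small[of "\<phi> - y"] y unfolding osc_le_def by auto
    \<comment> \<open>The budget is \<open>e / 4\<close> for each of the two arguments and
      \<open>e / 8\<close> for each of the two levels \<open>m\<close> and \<open>n\<close>, in
      total \<open>3/4 * e\<close>.\<close>
    have "eventually (\<lambda>m. rec_error m < e / 8) sequentially"
      using e by (intro order_tendstoD(2)[OF rec_error_tendsto]) simp
    then obtain N3 where N3: "rec_error m < e / 8" if "m \<ge> N3" for m
      unfolding eventually_sequentially by blast
    show ?thesis
      unfolding osc_le_def
    proof (intro exI[of _ "max N1 (max N2 N3)"] allI impI)
      fix m n assume "m \<ge> max N1 (max N2 N3)" "n \<ge> max N1 (max N2 N3)"
      then have "\<bar>scaled_count m (y - 1) - scaled_count n (y - 1)\<bar> \<le> e / 4"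
        "\<bar>scaled_count m (\<phi> - y) - scaled_count n (\<phi> - y)\<bar> \<le> e / 4"
        "rec_error m < e / 8" "rec_error n < e / 8"
        using N1 N2 N3 by auto
      then show "\<bar>scaled_count m y - scaled_count n y\<bar> \<le> 3/4 * e"
        using scaled_count_recurrence[OF y, of m] scaled_count_recurrence[OF y, of n]
        by linarith
    qed
  qed
  consider "x \<le> \<phi> - 1" | "\<phi> - 1 \<le> x" "x \<le> 1" | "1 \<le> x" by linarith
  then show ?thesis
  proof cases
    case 1
    then show ?thesis using small[of x] x e by (auto intro: osc_le_mono)
  next
    case 2
    \<comment> \<open>One scaling by \<open>\<phi>\<close> carries the middle range into
      \<open>[1, \<phi>]\<close>, already treated.\<close>
    have "1 \<le> \<phi> * x"
      using mult_left_mono[OF 2(1), of \<phi>] phi_mult_self by (simp add: algebra_simps)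
    moreover have "\<phi> * x \<le> \<phi>" using 2 by simp
    ultimately have "osc_le x (3/4 * e / 2)" by (intro osc_le_scale large)
    then show ?thesis using e by (auto intro: osc_le_mono)
  qed (use large x in auto)
qed

lemma osc_le_power: "0 \<le> x \<Longrightarrow> x \<le> \<phi> \<Longrightarrow> osc_le x ((3/4) ^ k * 8)"
proof (induction k arbitrary: x)
  case 0
  have "\<bar>scaled_count m x - scaled_count n x\<bar> \<le> 8" for m n
    using scaled_count_le[OF 0(2)] scaled_count_nonneg[of _ x]
    by (smt (verit, best))
  then show ?case by (simp add: osc_le_def)
next
  case (Suc k)
  then show ?case
    using osc_le_contract[of "(3/4) ^ k * 8" x] by simp
qed

lemma scaled_count_convergent:
  assumes "0 \<le> x" "x \<le> \<phi>"
  shows "convergent (\<lambda>m. scaled_count m x)"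
proof (rule Cauchy_convergent, rule metric_CauchyI)
  fix e :: real assume e: "0 < e"
  have "(\<lambda>k. (3/4) ^ k * 8 :: real) \<longlonglongrightarrow> 0"
    by (intro tendsto_mult_left_zero LIMSEQ_power_zero) simp
  then have "eventually (\<lambda>k. (3/4) ^ k * 8 < e) sequentially"
    using e by (intro order_tendstoD(2))
  then obtain k where k: "(3/4) ^ k * 8 < e"
    unfolding eventually_sequentially by blast
  obtain N where "\<bar>scaled_count m x - scaled_count n x\<bar> \<le> (3/4) ^ k * 8" if "m \<ge> N" "n \<ge> N" for m n
    using osc_le_power[OF assms, of k] unfolding osc_le_def by blast
  then show "\<exists>N. \<forall>m\<ge>N. \<forall>n\<ge>N. dist (scaled_count m x) (scaled_count n x) < e"
    using k unfolding dist_real_def by (meson order_le_less_trans)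
qed

section \<open>The limit and its functional equations\<close>

definition G :: "real \<Rightarrow> real" where
  "G x = lim (\<lambda>m. scaled_count m x)"

lemma scaled_count_tendsto:
  "0 \<le> x \<Longrightarrow> x \<le> \<phi> \<Longrightarrow> (\<lambda>m. scaled_count m x) \<longlonglongrightarrow> G x"
  unfolding G_def using scaled_count_convergent convergent_LIMSEQ_iff by blast

lemma G_mono: "0 \<le> x \<Longrightarrow> x \<le> y \<Longrightarrow> y \<le> \<phi> \<Longrightarrow> G x \<le> G y"
  by (rule LIMSEQ_le[OF scaled_count_tendsto scaled_count_tendsto]) (auto intro: scaled_count_mono)

lemma G_scale:
  assumes "0 \<le> x" "\<phi> * x \<le> \<phi>"
  shows "G (\<phi> * x) = 2 * G x"
proof -
  have "x \<le> 1" using assms by simp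
  then have "(\<lambda>m. scaled_count (Suc m) x) \<longlonglongrightarrow> G x"
    using assms by (intro LIMSEQ_Suc scaled_count_tendsto) (auto intro: order_trans[of _ 1])
  moreover have "(\<lambda>m. scaled_count (Suc m) x) \<longlonglongrightarrow> G (\<phi> * x) / 2"
    unfolding scaled_count_Suc using assms by (intro tendsto_divide scaled_count_tendsto tendsto_const) auto
  ultimately show ?thesis using LIMSEQ_unique by fastforce
qed

lemma G_recurrence:
  assumes "1 \<le> x" "x \<le> \<phi>"
  shows "G x = 1 + G (x - 1) - G (\<phi> - x)"
proof -
  let ?f = "\<lambda>m. scaled_count m x - (1 + scaled_count m (x - 1) - scaled_count m (\<phi> - x))"
  have "?f \<longlonglongrightarrow> G x - (1 + G (x - 1) - G (\<phi> - x))"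
    using assms by (intro tendsto_intros scaled_count_tendsto) auto
  moreover have "?f \<longlonglongrightarrow> 0"
    using scaled_count_recurrence[OF assms]
    by (intro tendsto_0_le[OF rec_error_tendsto, where K = 1] always_eventually allI)
      (auto intro: order_trans[OF _ abs_ge_self])
  ultimately have "G x - (1 + G (x - 1) - G (\<phi> - x)) = 0" by (rule LIMSEQ_unique)
  then show ?thesis by simp
qed

lemma G_0: "G 0 = 0"
  using G_scale[of 0] by simp

text \<open>Scaling gives \<open>G 1\<close> as twice this value, and the recurrence at 1 gives it
  as one minus this value. With \<open>G 0\<close> it yields exact values at all cylinder
  endpoints.\<close>

lemma G_phi_minus_1: "G (\<phi> - 1) = 1 / 3"
proof -
  have "\<phi> * (\<phi> - 1) = 1" using phi_mult_self by (simp add: algebra_simps)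
  then have "G 1 = 2 * G (\<phi> - 1)"
    using G_scale[of "\<phi> - 1"] by simp
  moreover have "G 1 = 1 - G (\<phi> - 1)"
    using G_recurrence[of 1] by (simp add: G_0)
  ultimately show ?thesis by simp
qed

section \<open>Transfer to the limit inferior and superior\<close>

lemma phi_powr_exponent: "\<phi> powr fib_exponent = 2"
proof -
  have "ln \<phi> \<noteq> 0" using phi_pos(4) by (metis ln_gt_zero less_irrefl)
  then show ?thesis by (simp add: powr_def fib_exponent_def)
qed

lemma fib_exponent_pos: "0 < fib_exponent"
  by (simp add: fib_exponent_def)

text \<open>The normalising power at \<open>x * \<theta> m\<close>, divided by
  \<open>2 ^ (m + 2)\<close>; see \<open>theta_powr\<close>, whose factor 4 accounts for every later
  factor \<open>4 * growth x\<close>.\<close>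

definition growth :: "real \<Rightarrow> real" where
  "growth x = (x / sqrt 5) powr fib_exponent"

lemma growth_pos: "0 < x \<Longrightarrow> 0 < growth x"
  by (simp add: growth_def)

lemma growth_mono: "0 \<le> x \<Longrightarrow> x \<le> y \<Longrightarrow> growth x \<le> growth y"
  unfolding growth_def using fib_exponent_pos by (intro powr_mono2 divide_right_mono) auto

lemma growth_phi_powr: "growth (\<phi> powr t * x) = 2 powr t * growth x"
proof -
  have "growth (\<phi> powr t * x) = (\<phi> powr t) powr fib_exponent * growth x"
    unfolding growth_def times_divide_eq_right[symmetric] by (rule powr_mult)
  also have "(\<phi> powr t) powr fib_exponent = 2 powr t"
    by (subst phi_powr_exponent[symmetric]) (simp add: powr_powr mult.commute)
  finally show ?thesis .
qed

lemma theta_powr: "(x * \<theta> m) powr fib_exponent = 4 * 2 ^ m * growth x"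
proof -
  have eq: "x * \<theta> m = (\<phi> powr real (m + 2) * x) / sqrt 5"
    unfolding \<theta>_def by (subst powr_realpow) auto
  have "2 powr real (m + 2) = (4 * 2 ^ m :: real)"
    by (subst powr_realpow) (auto simp: power_add)
  then show ?thesis
    using growth_phi_powr[of "real (m + 2)" x] by (simp add: eq growth_def)
qed

section \<open>Eventual bounds along a geometric grid\<close>

lemma A_le_scaled_count: "real h \<le> x * \<theta> m \<Longrightarrow> real (A (int h)) \<le> 2 ^ m * scaled_count m x"
  unfolding scaled_count_def by (auto intro!: A_mono simp: le_floor_iff)

lemma scaled_count_le_A: "x * \<theta> m \<le> real h \<Longrightarrow> 2 ^ m * scaled_count m x \<le> real (A (int h))"
  unfolding scaled_count_def by (auto intro!: A_mono simp: floor_le_iff)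

lemma geometric_grid:
  assumes "0 < N" "\<theta> M \<le> real H"
  obtains m i where "M \<le> m" "i < N" "\<phi> powr (real i / real N) * \<theta> m \<le> real H"
    "real H < \<phi> powr (real (Suc i) / real N) * \<theta> m"
proof -
  define y where "y = real H / \<theta> 0"
  have \<theta>: "\<theta> m = \<phi> powr real m * \<theta> 0" for m
    by (subst powr_realpow) (auto simp: \<theta>_def power_add)
  have y\<theta>: "y * \<theta> 0 = real H"
    by (simp add: y_def)
  have "\<phi> powr real M * \<theta> 0 \<le> y * \<theta> 0"
    using assms(2) unfolding \<theta>[of M] y\<theta> .
  then have yM: "\<phi> powr real M \<le> y" by simp
  then have y0: "0 < y" by (rule less_le_trans[rotated]) simp
  have logM: "real M \<le> log \<phi> y"
    using yM y0 by (subst le_log_iff) auto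
  \<comment> \<open>The cell number on the logarithmic scale; division by \<open>N\<close> gives the
    level \<open>m\<close> and the position \<open>i\<close> within it.\<close>
  define e where "e = nat \<lfloor>real N * log \<phi> y\<rfloor>"
  have nonneg: "0 \<le> real N * log \<phi> y" using logM by (intro mult_nonneg_nonneg) auto
  have e: "real e \<le> real N * log \<phi> y" "real N * log \<phi> y < real (Suc e)"
    using nonneg unfolding e_def by linarith+
  define m i where "m = e div N" and "i = e mod N"
  have split: "real e = real N * real m + real i"
    unfolding m_def i_def by (metis mult_div_mod_eq of_nat_add of_nat_mult)
  have "real N * real M < real (Suc e)"
    using e(2) mult_left_mono[OF logM, of "real N"] by linarith
  then have "N * M \<le> e"
    by (metis less_Suc_eq_le of_nat_less_iff of_nat_mult)
  then have "M \<le> m"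
    using assms(1) unfolding m_def by (simp add: less_eq_div_iff_mult_less_eq mult.commute)
  moreover have "i < N" using assms(1) by (simp add: i_def)
  moreover have "\<phi> powr (real i / real N) * \<theta> m \<le> real H"
  proof -
    have "real i / real N + real m \<le> log \<phi> y"
      using e(1) split assms(1) by (simp add: field_simps)
    then have "\<phi> powr (real i / real N + real m) \<le> y"
      using y0 by (subst (asm) le_log_iff) auto
    then have "\<phi> powr (real i / real N + real m) * \<theta> 0 \<le> y * \<theta> 0"
      by (intro mult_right_mono) (auto simp: less_imp_le)
    then show ?thesis unfolding \<theta>[of m] y\<theta> by (simp add: powr_add mult.assoc)
  qed
  moreover have "real H < \<phi> powr (real (Suc i) / real N) * \<theta> m"
  proof -
    have "log \<phi> y < real (Suc i) / real N + real m"
      using e(2) split assms(1) by (simp add: field_simps)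
    then have "y < \<phi> powr (real (Suc i) / real N + real m)"
      using y0 by (subst (asm) log_less_iff) auto
    then have "y * \<theta> 0 < \<phi> powr (real (Suc i) / real N + real m) * \<theta> 0"
      by (intro mult_strict_right_mono) auto
    then show ?thesis unfolding \<theta>[of m] y\<theta> by (simp add: powr_add mult.assoc)
  qed
  ultimately show ?thesis by (rule that)
qed

lemma phi_powr_range:
  assumes "i \<le> N" "0 < N"
  shows "1 \<le> \<phi> powr (real i / real N)" "\<phi> powr (real i / real N) \<le> \<phi>"
proof -
  show "1 \<le> \<phi> powr (real i / real N)" by (intro ge_one_powr_ge_zero) auto
  have "\<phi> powr (real i / real N) \<le> \<phi> powr 1"
    using assms by (intro powr_mono) auto
  then show "\<phi> powr (real i / real N) \<le> \<phi>" by simp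
qed

lemma eventually_theta_le: "eventually (\<lambda>H. \<theta> M \<le> real H) sequentially"
  using filterlim_real_sequentially by (simp add: filterlim_at_top)

lemma growth_grid_Suc:
  "growth (\<phi> powr (real (Suc i) / real N)) =
    2 powr (1 / real N) * growth (\<phi> powr (real i / real N))"
proof -
  have "\<phi> powr (real (Suc i) / real N) = \<phi> powr (1 / real N) * \<phi> powr (real i / real N)"
    by (simp add: add_divide_distrib flip: powr_add)
  then show ?thesis by (simp add: growth_phi_powr)
qed

text \<open>For fixed \<open>N\<close> only finitely many grid points occur, so pointwise
  convergence suffices. One factor \<open>2 powr (1 / real N)\<close> pays for moving
  \<open>H\<close> across a grid cell, the other for the distance of \<open>scaled_count\<close>
  from its limit.\<close>

lemma eventually_ratio_ge:
  assumes N: "0 < N" and c: "0 < c"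
    and G: "\<And>x. 1 \<le> x \<Longrightarrow> x \<le> \<phi> \<Longrightarrow> 4 * c * growth x \<le> G x"
  shows "eventually (\<lambda>H. c / (2 powr (1 / real N))\<^sup>2 \<le> real (A (int H)) / real H powr fib_exponent) sequentially"
proof -
  define r :: real where "r = 2 powr (1 / real N)"
  have r: "1 < r" unfolding r_def using N by (intro gr_one_powr) auto
  define x where "x i = \<phi> powr (real i / real N)" for i
  have x: "1 \<le> x i" "x i \<le> \<phi>" if "i \<le> N" for i
    unfolding x_def using phi_powr_range that N by auto
  have "eventually (\<lambda>m. 4 * c * growth (x i) / r < scaled_count m (x i)) sequentially" if "i < N" for i
  proof (rule order_tendstoD(1)[OF scaled_count_tendsto])
    have pos: "0 < 4 * c * growth (x i)"
      using c x[of i] that by (intro mult_pos_pos growth_pos) auto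
    have "4 * c * growth (x i) / r < 4 * c * growth (x i)"
      using divide_strict_left_mono[OF r pos] r by simp
    also have "\<dots> \<le> G (x i)" using x[of i] that by (intro G) auto
    finally show "4 * c * growth (x i) / r < G (x i)" .
  qed (use x[of i] that in auto)
  then have "eventually (\<lambda>m. \<forall>i\<in>{..<N}. 4 * c * growth (x i) / r < scaled_count m (x i)) sequentially"
    by (intro eventually_ball_finite) auto
  then obtain M where M: "4 * c * growth (x i) / r < scaled_count m (x i)" if "m \<ge> M" "i < N" for m i
    unfolding eventually_sequentially by auto
  have "c / r\<^sup>2 \<le> real (A (int H)) / real H powr fib_exponent" if H: "\<theta> M \<le> real H" for H
  proof -
    obtain m i where mi: "M \<le> m" "i < N" "x i * \<theta> m \<le> real H" "real H < x (Suc i) * \<theta> m"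
      using geometric_grid[OF N H] unfolding x_def by metis
    have g: "0 < growth (x i)" using x[of i] mi(2) by (intro growth_pos) auto
    have H0: "0 < real H" using H theta_pos[of M] by linarith
    have "real H powr fib_exponent \<le> (x (Suc i) * \<theta> m) powr fib_exponent"
      using mi(4) fib_exponent_pos by (intro powr_mono2) auto
    also have "\<dots> = 4 * 2 ^ m * (r * growth (x i))"
      unfolding theta_powr x_def r_def growth_grid_Suc ..
    finally have "c / r\<^sup>2 * real H powr fib_exponent \<le> c / r\<^sup>2 * (4 * 2 ^ m * (r * growth (x i)))"
      using c by (intro mult_left_mono) auto
    also have "\<dots> = 2 ^ m * (4 * c * growth (x i) / r)"
      using r by (simp add: power2_eq_square field_simps)
    also have "\<dots> \<le> 2 ^ m * scaled_count m (x i)"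
      using M[OF mi(1,2)] by (intro mult_left_mono) auto
    also have "\<dots> \<le> real (A (int H))" by (rule scaled_count_le_A[OF mi(3)])
    finally show ?thesis using H0 by (subst pos_le_divide_eq) auto
  qed
  then show ?thesis
    unfolding r_def by (rule eventually_mono[OF eventually_theta_le])
qed

text \<open>Mirrors the lower bound, but monotonicity now needs the right end of each cell, so the
  grid index runs up to \<open>N\<close> inclusive.\<close>

lemma eventually_ratio_le:
  assumes N: "0 < N" and c: "0 < c"
    and G: "\<And>x. 1 \<le> x \<Longrightarrow> x \<le> \<phi> \<Longrightarrow> G x \<le> 4 * c * growth x"
  shows "eventually (\<lambda>H. real (A (int H)) / real H powr fib_exponent \<le> c * (2 powr (1 / real N))\<^sup>2) sequentially"
proof -
  define r :: real where "r = 2 powr (1 / real N)"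
  have r: "1 < r" unfolding r_def using N by (intro gr_one_powr) auto
  define x where "x i = \<phi> powr (real i / real N)" for i
  have x: "1 \<le> x i" "x i \<le> \<phi>" if "i \<le> N" for i
    unfolding x_def using phi_powr_range that N by auto
  have "eventually (\<lambda>m. scaled_count m (x i) < 4 * c * growth (x i) * r) sequentially" if "i \<le> N" for i
  proof (rule order_tendstoD(2)[OF scaled_count_tendsto])
    have pos: "0 < 4 * c * growth (x i)"
      using c x[of i] that by (intro mult_pos_pos growth_pos) auto
    have "G (x i) \<le> 4 * c * growth (x i)" using x[of i] that by (intro G) auto
    also have "\<dots> < 4 * c * growth (x i) * r"
      using mult_strict_left_mono[OF r pos] by simp
    finally show "G (x i) < 4 * c * growth (x i) * r" .
  qed (use x[of i] that in auto)
  then have "eventually (\<lambda>m. \<forall>i\<in>{..N}. scaled_count m (x i) < 4 * c * growth (x i) * r) sequentially"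
    by (intro eventually_ball_finite) auto
  then obtain M where M: "scaled_count m (x i) < 4 * c * growth (x i) * r" if "m \<ge> M" "i \<le> N" for m i
    unfolding eventually_sequentially by auto
  have "real (A (int H)) / real H powr fib_exponent \<le> c * r\<^sup>2" if H: "\<theta> M \<le> real H" for H
  proof -
    obtain m i where mi: "M \<le> m" "i < N" "x i * \<theta> m \<le> real H" "real H < x (Suc i) * \<theta> m"
      using geometric_grid[OF N H] unfolding x_def by metis
    have H0: "0 < real H" using H theta_pos[of M] by linarith
    have "real (A (int H)) \<le> 2 ^ m * scaled_count m (x (Suc i))"
      using mi(4) by (intro A_le_scaled_count) simp
    also have "\<dots> \<le> 2 ^ m * (4 * c * growth (x (Suc i)) * r)"
      using M[OF mi(1), of "Suc i"] mi(2) by (intro mult_left_mono) auto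
    also have "growth (x (Suc i)) = r * growth (x i)"
      unfolding x_def r_def by (rule growth_grid_Suc)
    also have "2 ^ m * (4 * c * (r * growth (x i)) * r) = c * r\<^sup>2 * (4 * 2 ^ m * growth (x i))"
      by (simp add: power2_eq_square)
    also have "4 * 2 ^ m * growth (x i) = (x i * \<theta> m) powr fib_exponent"
      by (simp add: theta_powr)
    also have "c * r\<^sup>2 * \<dots> \<le> c * r\<^sup>2 * real H powr fib_exponent"
      using mi(3) fib_exponent_pos c x[of i] mi(2) by (intro mult_left_mono powr_mono2 mult_nonneg_nonneg) (auto simp: less_imp_le)
    finally show ?thesis using H0 by (subst pos_divide_le_eq) auto
  qed
  then show ?thesis
    unfolding r_def by (rule eventually_mono[OF eventually_theta_le])
qed

lemma grid_ratio_tendsto: "(\<lambda>N. (2 powr (1 / real N))\<^sup>2) \<longlonglongrightarrow> (1::real)"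
proof -
  have "(\<lambda>N. (2 powr (1 / real N))\<^sup>2 :: real) \<longlonglongrightarrow> (2 powr 0)\<^sup>2"
    by (intro tendsto_intros lim_1_over_n) auto
  then show ?thesis by simp
qed

text \<open>Refining the grid sends the loss factor to 1.\<close>

lemma le_liminf_ratio:
  assumes c: "0 < c" and G: "\<And>x. 1 \<le> x \<Longrightarrow> x \<le> \<phi> \<Longrightarrow> 4 * c * growth x \<le> G x"
  shows "ereal c \<le> liminf (\<lambda>H. ereal (real (A (int H)) / real H powr fib_exponent))"
proof (rule le_Liminf_iff[THEN iffD2], intro allI impI)
  fix y assume y: "y < ereal c"
  have "eventually (\<lambda>N. y < ereal (c / (2 powr (1 / real N))\<^sup>2)) sequentially"
  proof (rule order_tendstoD(1)[OF _ y])
    have "(\<lambda>N. c / (2 powr (1 / real N))\<^sup>2) \<longlonglongrightarrow> c / 1"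
      by (intro tendsto_intros grid_ratio_tendsto) auto
    then show "(\<lambda>N. ereal (c / (2 powr (1 / real N))\<^sup>2)) \<longlonglongrightarrow> ereal c" by simp
  qed
  with eventually_gt_at_top[of 0]
  have "eventually (\<lambda>N::nat. 0 < N \<and> y < ereal (c / (2 powr (1 / real N))\<^sup>2)) sequentially"
    by (rule eventually_conj)
  then obtain N :: nat where "0 < N" and N: "y < ereal (c / (2 powr (1 / real N))\<^sup>2)"
    unfolding eventually_sequentially by blast
  show "eventually (\<lambda>H. y < ereal (real (A (int H)) / real H powr fib_exponent)) sequentially"
    by (rule eventually_mono[OF eventually_ratio_ge[OF \<open>0 < N\<close> c]])
      (erule (1) G, rule less_le_trans[OF N ereal_less_eq(3)[THEN iffD2]])
qed

lemma limsup_ratio_le: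
  assumes c: "0 < c" and G: "\<And>x. 1 \<le> x \<Longrightarrow> x \<le> \<phi> \<Longrightarrow> G x \<le> 4 * c * growth x"
  shows "limsup (\<lambda>H. ereal (real (A (int H)) / real H powr fib_exponent)) \<le> ereal c"
proof (rule Limsup_le_iff[THEN iffD2], intro allI impI)
  fix y assume y: "ereal c < y"
  have "eventually (\<lambda>N. ereal (c * (2 powr (1 / real N))\<^sup>2) < y) sequentially"
  proof (rule order_tendstoD(2)[OF _ y])
    have "(\<lambda>N. c * (2 powr (1 / real N))\<^sup>2) \<longlonglongrightarrow> c * 1"
      by (intro tendsto_intros grid_ratio_tendsto)
    then show "(\<lambda>N. ereal (c * (2 powr (1 / real N))\<^sup>2)) \<longlonglongrightarrow> ereal c" by simp
  qed
  with eventually_gt_at_top[of 0]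
  have "eventually (\<lambda>N::nat. 0 < N \<and> ereal (c * (2 powr (1 / real N))\<^sup>2) < y) sequentially"
    by (rule eventually_conj)
  then obtain N :: nat where "0 < N" and N: "ereal (c * (2 powr (1 / real N))\<^sup>2) < y"
    unfolding eventually_sequentially by blast
  show "eventually (\<lambda>H. ereal (real (A (int H)) / real H powr fib_exponent) < y) sequentially"
    by (rule eventually_mono[OF eventually_ratio_le[OF \<open>0 < N\<close> c]])
      (erule (1) G, rule le_less_trans[OF ereal_less_eq(3)[THEN iffD2] N])
qed

text \<open>With \<open>H m\<close> the floor of \<open>x * \<theta> m\<close>, the numerator is
  exactly \<open>2 ^ m * scaled_count m x\<close>, and \<open>H m / \<theta> m\<close> tends to
  \<open>x\<close>, so continuity of \<open>growth\<close> settles the denominator.\<close>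

lemma ratio_tendsto_along:
  assumes x: "1 \<le> x" "x \<le> \<phi>"
  obtains H :: "nat \<Rightarrow> nat" where "filterlim H at_top sequentially"
    "(\<lambda>m. ereal (real (A (int (H m))) / real (H m) powr fib_exponent)) \<longlonglongrightarrow> ereal (G x / (4 * growth x))"
proof -
  define H where "H m = nat \<lfloor>x * \<theta> m\<rfloor>" for m
  have \<theta>_top: "filterlim \<theta> at_top sequentially"
  proof -
    have "filterlim (\<lambda>m. \<phi> ^ m) at_top sequentially"
      by (rule filterlim_realpow_sequentially_gt1[THEN filterlim_at_infinity_imp_filterlim_at_top]) auto
    then have "filterlim (\<lambda>m. (\<phi>\<^sup>2 / sqrt 5) * \<phi> ^ m) at_top sequentially"
      by (intro filterlim_tendsto_pos_mult_at_top[OF tendsto_const]) auto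
    then show ?thesis by (simp add: \<theta>_def[abs_def] power2_eq_square mult_ac)
  qed
  have floor: "int (H m) = \<lfloor>x * \<theta> m\<rfloor>" for m
    using x by (simp add: H_def less_imp_le)
  have H: "real (H m) \<le> x * \<theta> m" "x * \<theta> m < real (H m) + 1" for m
    using floor_correct[of "x * \<theta> m"] by (simp_all flip: floor)
  have y_lim: "(\<lambda>m. real (H m) / \<theta> m) \<longlonglongrightarrow> x"
  proof (rule real_tendsto_sandwich[OF always_eventually always_eventually])
    show "\<forall>m. real (H m) / \<theta> m \<le> x"
      using H(1) by (simp add: pos_divide_le_eq)
    show "\<forall>m. x - 1 / \<theta> m \<le> real (H m) / \<theta> m"
    proof
      fix m
      have "x \<le> (real (H m) + 1) / \<theta> m"
        using H(2)[of m] by (simp add: pos_le_divide_eq)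
      then show "x - 1 / \<theta> m \<le> real (H m) / \<theta> m"
        by (simp add: add_divide_distrib)
    qed
    have "(\<lambda>m. 1 / \<theta> m) \<longlonglongrightarrow> 0"
      using tendsto_inverse_0_at_top[OF \<theta>_top] by (simp add: field_simps)
    then show "(\<lambda>m. x - 1 / \<theta> m) \<longlonglongrightarrow> x"
      using tendsto_diff[OF tendsto_const[of x]] by fastforce
  qed simp
  have "(\<lambda>m. growth (real (H m) / \<theta> m)) \<longlonglongrightarrow> growth x"
    unfolding growth_def using x by (intro tendsto_intros y_lim) auto
  then have "(\<lambda>m. scaled_count m x / (4 * growth (real (H m) / \<theta> m))) \<longlonglongrightarrow> G x / (4 * growth x)"
    using x growth_pos[of x] by (intro tendsto_intros scaled_count_tendsto) auto
  moreover have "scaled_count m x / (4 * growth (real (H m) / \<theta> m)) =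
      real (A (int (H m))) / real (H m) powr fib_exponent" for m
    using theta_powr[of "real (H m) / \<theta> m" m] by (simp add: scaled_count_def floor less_imp_le field_simps)
  ultimately have "(\<lambda>m. real (A (int (H m))) / real (H m) powr fib_exponent) \<longlonglongrightarrow> G x / (4 * growth x)"
    by simp
  moreover have "filterlim H at_top sequentially"
  proof -
    have "filterlim (\<lambda>m. \<theta> m - 1) at_top sequentially"
      using filterlim_tendsto_add_at_top[OF tendsto_const[of "-1"] \<theta>_top] by simp
    moreover have "\<theta> m - 1 \<le> real (H m)" for m
    proof -
      have "\<theta> m \<le> x * \<theta> m" using x by simp
      then show ?thesis using H(2)[of m] by linarith
    qed
    ultimately have "filterlim (\<lambda>m. real (H m)) at_top sequentially"
      by (auto intro: filterlim_at_top_mono always_eventually)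
    then show ?thesis by (simp add: filterlim_sequentially_iff_filterlim_real)
  qed
  ultimately show ?thesis by (intro that) auto
qed

lemma Liminf_le_limit_along:
  fixes f :: "'a \<Rightarrow> ereal"
  assumes "filterlim h K E" "E \<noteq> bot" "((\<lambda>n. f (h n)) \<longlongrightarrow> l) E"
  shows "Liminf K f \<le> l"
proof (rule ccontr)
  assume "\<not> Liminf K f \<le> l"
  then obtain y where y: "l < y" "y < Liminf K f"
    using dense not_le by metis
  have "eventually (\<lambda>n. y < f (h n)) E"
    using less_LiminfD[OF y(2)] assms(1) by (rule eventually_compose_filterlim)
  then have "y \<le> l"
    using assms by (intro tendsto_lowerbound[OF assms(3)]) (auto elim: eventually_mono)
  with y(1) show False by simp
qed

lemma limit_along_le_Limsup:
  fixes f :: "'a \<Rightarrow> ereal"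
  assumes "filterlim h K E" "E \<noteq> bot" "((\<lambda>n. f (h n)) \<longlongrightarrow> l) E"
  shows "l \<le> Limsup K f"
proof (rule ccontr)
  assume "\<not> l \<le> Limsup K f"
  then obtain y where y: "Limsup K f < y" "y < l"
    using dense not_le by metis
  have "eventually (\<lambda>n. f (h n) < y) E"
    using Limsup_lessD[OF y(1)] assms(1) by (rule eventually_compose_filterlim)
  then have "l \<le> y"
    using assms by (intro tendsto_upperbound[OF assms(3)]) (auto elim: eventually_mono)
  with y(2) show False by simp
qed

lemma liminf_ratio_le:
  assumes "1 \<le> x" "x \<le> \<phi>"
  shows "liminf (\<lambda>H. ereal (real (A (int H)) / real H powr fib_exponent)) \<le> ereal (G x / (4 * growth x))"
  by (rule ratio_tendsto_along[OF assms]) (rule Liminf_le_limit_along, auto)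

lemma le_limsup_ratio:
  assumes "1 \<le> x" "x \<le> \<phi>"
  shows "ereal (G x / (4 * growth x)) \<le> limsup (\<lambda>H. ereal (real (A (int H)) / real H powr fib_exponent))"
  by (rule ratio_tendsto_along[OF assms]) (rule limit_along_le_Limsup, auto)

section \<open>Rational bounds for the growth function\<close>

text \<open>Concavity of the power: its graph lies below the tangent at 1. The proof is weighted
  AM-GM, applying \<open>ln t \<le> t - 1\<close> at \<open>u / z\<close> and
  \<open>1 / z\<close>.\<close>

lemma powr_le_affine:
  fixes u a :: real
  assumes "0 < u" "0 \<le> a" "a \<le> 1"
  shows "u powr a \<le> 1 + a * (u - 1)"
proof -
  define z where "z = 1 + a * (u - 1)"
  have "z = a * u + (1 - a)" by (simp add: z_def algebra_simps)
  moreover have "0 < a * u + (1 - a)"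
    using assms by (cases "a = 0") (auto intro!: add_pos_nonneg)
  ultimately have z: "0 < z" by simp
  have "a * ln (u / z) + (1 - a) * ln (1 / z) \<le> a * (u / z - 1) + (1 - a) * (1 / z - 1)"
    using assms z by (intro add_mono mult_left_mono ln_le_minus_one) auto
  also have "\<dots> = (a * u + (1 - a)) / z - 1"
    by (simp add: algebra_simps add_divide_distrib diff_divide_distrib)
  also have "\<dots> = 0"
    using z \<open>z = a * u + (1 - a)\<close> by simp
  finally have "a * ln u \<le> ln z"
    using assms z by (simp add: ln_div algebra_simps)
  then have "exp (a * ln u) \<le> z"
    using z by (simp add: ln_ge_iff)
  then show ?thesis
    using assms by (simp add: powr_def z_def)
qed

lemma fib_exponent_gt:
  assumes "0 < q" "\<phi> ^ p < 2 ^ q"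
  shows "real p / real q < fib_exponent"
proof -
  have "ln (\<phi> ^ p) < ln (2 ^ q)"
    using assms(2) by (subst ln_less_cancel_iff) auto
  then have "real p * ln \<phi> < real q * ln 2" by (simp add: ln_realpow)
  then show ?thesis
    using assms(1) by (simp add: fib_exponent_def field_simps)
qed

lemma fib_exponent_less:
  assumes "0 < q" "2 ^ q < \<phi> ^ p"
  shows "fib_exponent < real p / real q"
proof -
  have "ln (2 ^ q) < ln (\<phi> ^ p)"
    using assms(2) by (subst ln_less_cancel_iff) auto
  then have "real q * ln 2 < real p * ln \<phi>" by (simp add: ln_realpow)
  then show ?thesis
    using assms(1) by (simp add: fib_exponent_def field_simps)
qed

section \<open>Enclosures of the golden ratio, its powers and the exponent\<close>

lemma phi_lower: "7286977268806823 / 2 ^ 52 < \<phi>"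
proof -
  have "7286977268806823 / 2 ^ 51 - 1 < sqrt 5"
    by (rule real_less_rsqrt) (simp add: power2_eq_square field_simps)
  then show ?thesis by (simp add: golden_ratio_def)
qed

lemma phi_upper: "\<phi> < 7286977268806824 / 2 ^ 52"
proof -
  have "sqrt 5 < 7286977268806824 / 2 ^ 51 - 1"
    by (rule real_less_lsqrt) (simp_all add: power2_eq_square field_simps)
  then show ?thesis by (simp add: golden_ratio_def)
qed

lemma phi_power_add:
  assumes "\<phi> ^ m = x + y * \<phi>" "\<phi> ^ n = u + v * \<phi>"
  shows "\<phi> ^ (m + n) = (x * u + y * v) + (x * v + y * u + y * v) * \<phi>"
proof -
  have "\<phi> ^ (m + n) = x * u + (x * v + y * u) * \<phi> + y * v * (\<phi> * \<phi>)"
    unfolding power_add assms by (simp add: algebra_simps)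
  then show ?thesis
    unfolding phi_mult_self by (simp add: algebra_simps)
qed

text \<open>The coefficients are consecutive Fibonacci numbers, computed along an addition chain;
  the exponents listed are those of the comparisons with powers of 2 and of the base points.\<close>

lemma phi_powers:
  "\<phi> ^ 60 = 956722026041 + 1548008755920 * \<phi>"
  "\<phi> ^ 62 = 2504730781961 + 4052739537881 * \<phi>"
  "\<phi> ^ 118 = 1264937032042997393488322 + 2046711111473984623691759 * \<phi>"
  "\<phi> ^ 121 = 5358359254990966640871840 + 8670007398507948658051921 * \<phi>"
  "\<phi> ^ 134 = 2791715456571051233611642553 + 4517090495650391871408712937 * \<phi>"
  "\<phi> ^ 278 = 3468097888158339286797581652104954628434169971646694834457 + 5611500259351924431073312796924978741056961814867751431689 * \<phi>"
proof -
  have p1: "\<phi> ^ 1 = 0 + 1 * \<phi>" by simp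
  have p2: "\<phi>\<^sup>2 = 1 + 1 * \<phi>"
    by (simp add: phi_square)
  have p4: "\<phi> ^ 4 = 2 + 3 * \<phi>"
    using phi_power_add[OF p2 p2] by simp
  have p8: "\<phi> ^ 8 = 13 + 21 * \<phi>"
    using phi_power_add[OF p4 p4] by simp
  have p12: "\<phi> ^ 12 = 89 + 144 * \<phi>"
    using phi_power_add[OF p8 p4] by simp
  have p14: "\<phi> ^ 14 = 233 + 377 * \<phi>"
    using phi_power_add[OF p12 p2] by simp
  have p28: "\<phi> ^ 28 = 196418 + 317811 * \<phi>"
    using phi_power_add[OF p14 p14] by simp
  have p56: "\<phi> ^ 56 = 139583862445 + 225851433717 * \<phi>"
    using phi_power_add[OF p28 p28] by simp
  show p60: "\<phi> ^ 60 = 956722026041 + 1548008755920 * \<phi>"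
    using phi_power_add[OF p56 p4] by simp
  show p62: "\<phi> ^ 62 = 2504730781961 + 4052739537881 * \<phi>"
    using phi_power_add[OF p60 p2] by simp
  show p118: "\<phi> ^ 118 = 1264937032042997393488322 + 2046711111473984623691759 * \<phi>"
    using phi_power_add[OF p62 p56] by simp
  have p120: "\<phi> ^ 120 = 3311648143516982017180081 + 5358359254990966640871840 * \<phi>"
    using phi_power_add[OF p60 p60] by simp
  show p121: "\<phi> ^ 121 = 5358359254990966640871840 + 8670007398507948658051921 * \<phi>"
    using phi_power_add[OF p120 p1] by simp
  show p134: "\<phi> ^ 134 = 2791715456571051233611642553 + 4517090495650391871408712937 * \<phi>"
    using phi_power_add[OF p120 p14] by simp
  have p268: "\<phi> ^ 268 = 28197781736352815952563206467131172508227658829511523778 + 45624969256769882625644229676772632057353264935332782291 * \<phi>"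
    using phi_power_add[OF p134 p134] by simp
  have p276: "\<phi> ^ 276 = 1324695516964754142521850507284930515811378128425638237225 + 2143402371193585144275731144820024112622791843221056597232 * \<phi>"
    using phi_power_add[OF p268 p8] by simp
  show p278: "\<phi> ^ 278 = 3468097888158339286797581652104954628434169971646694834457 + 5611500259351924431073312796924978741056961814867751431689 * \<phi>"
    using phi_power_add[OF p276 p2] by simp
qed

lemma phi_power_278: "\<phi> ^ 278 \<le> 12547696035668603309491634844074023725286141502763575625495"
  using phi_upper by (simp add: phi_powers)

lemma phi_power_121: "19386725908489880485632023 \<le> \<phi> ^ 121"
  using phi_lower by (simp add: phi_powers)

text \<open>The fraction 278/193 lies just below the exponent; it is then rounded down to
  denominator \<open>2 ^ 14\<close>.\<close>

lemma fib_exponent_lower: "1 + 7215 / 2 ^ 14 < fib_exponent"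
proof -
  have "\<phi> ^ 278 < 2 ^ 193"
    using phi_power_278 by (rule le_less_trans) simp
  then have "real 278 / real 193 < fib_exponent"
    by (intro fib_exponent_gt) auto
  then show ?thesis by simp
qed

text \<open>The fraction 121/84 lies just above the exponent; it is then rounded up.\<close>

lemma fib_exponent_upper: "fib_exponent < 1 + 7217 / 2 ^ 14"
proof -
  have "2 ^ 84 < \<phi> ^ 121"
    using phi_power_121 by (rule less_le_trans[rotated]) simp
  then have "fib_exponent < real 121 / real 84"
    by (intro fib_exponent_less) auto
  then show ?thesis by simp
qed

text \<open>An integer \<open>y\<close> stands for \<open>u = y / 2\<^sup>4\<^sup>0\<close>.  The slopes \<open>7215 / 2\<^sup>1\<^sup>4\<close> and \<open>7217 / 2\<^sup>1\<^sup>4\<close> enclose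
  \<open>\<lambda> - 1\<close>, so that \<open>9167 / 2\<^sup>1\<^sup>4\<close> and \<open>9169 / 2\<^sup>1\<^sup>4\<close> enclose \<open>2 - \<lambda>\<close>.\<close>

definition affine_up :: "int \<Rightarrow> int" where
  "affine_up y = 2 ^ 54 + (if 2 ^ 40 \<le> y then 7217 else 7215) * (y - 2 ^ 40)"

definition affine_dn :: "int \<Rightarrow> int" where
  "affine_dn y = 2 ^ 54 + (if 2 ^ 40 \<le> y then 9169 else 9167) * (y - 2 ^ 40)"

text \<open>One factor \<open>u\<close> is split off, leaving an exponent in \<open>[0, 1]\<close>
  for the tangent bound. The slope depends on the side of 1 because the sign of \<open>u - 1\<close>
  changes; 94 is 40 + 54.\<close>

lemma powr_exponent_le:
  assumes "0 < y"
  shows "(real_of_int y / 2 ^ 40) powr fib_exponent \<le> real_of_int (y * affine_up y) / 2 ^ 94"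
proof -
  define u where "u = real_of_int y / 2 ^ 40"
  define l :: real where "l = (if 2 ^ 40 \<le> y then 7217 else 7215) / 2 ^ 14"
  have u: "0 < u" using assms by (simp add: u_def)
  have iff: "2 ^ 40 \<le> y \<longleftrightarrow> 1 \<le> u"
  proof -
    have "2 ^ 40 \<le> y \<longleftrightarrow> real_of_int (2 ^ 40) \<le> real_of_int y" by (rule of_int_le_iff[symmetric])
    then show ?thesis by (simp add: u_def)
  qed
  have "u powr fib_exponent = u * u powr (fib_exponent - 1)"
    using u by (simp add: powr_diff)
  also have "\<dots> \<le> u * (1 + (fib_exponent - 1) * (u - 1))"
    using u fib_exponent_lower fib_exponent_upper by (intro mult_left_mono powr_le_affine) auto
  also have "\<dots> \<le> u * (1 + l * (u - 1))"
  proof (intro mult_left_mono add_left_mono)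
    show "(fib_exponent - 1) * (u - 1) \<le> l * (u - 1)"
    proof (cases "1 \<le> u")
      case True
      then have "fib_exponent - 1 \<le> l" using iff fib_exponent_upper by (simp add: l_def)
      with True show ?thesis by (intro mult_right_mono) auto
    next
      case False
      then have "l \<le> fib_exponent - 1" using iff fib_exponent_lower by (simp add: l_def)
      with False show ?thesis by (intro mult_right_mono_neg) auto
    qed
  qed (use u in simp)
  also have "\<dots> = real_of_int (y * affine_up y) / 2 ^ 94"
    by (simp add: u_def l_def affine_up_def field_simps)
  finally show ?thesis by (simp add: u_def)
qed

text \<open>The power is \<open>u\<^sup>2\<close> over \<open>u powr (2 - fib_exponent)\<close>, and
  the tangent bound is applied to that denominator; 26 is 80 - 54.\<close>

lemma powr_exponent_ge:
  assumes "0 < y"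
  shows "0 < affine_dn y"
    and "real_of_int (y * y) / (2 ^ 26 * real_of_int (affine_dn y)) \<le> (real_of_int y / 2 ^ 40) powr fib_exponent"
proof -
  define u where "u = real_of_int y / 2 ^ 40"
  define l :: real where "l = (if 2 ^ 40 \<le> y then 9169 else 9167) / 2 ^ 14"
  have u: "0 < u" using assms by (simp add: u_def)
  have iff: "2 ^ 40 \<le> y \<longleftrightarrow> 1 \<le> u"
  proof -
    have "2 ^ 40 \<le> y \<longleftrightarrow> real_of_int (2 ^ 40) \<le> real_of_int y" by (rule of_int_le_iff[symmetric])
    then show ?thesis by (simp add: u_def)
  qed
  have l: "0 < l" "l < 1" by (auto simp: l_def)
  have aff: "real_of_int (affine_dn y) / 2 ^ 54 = 1 + l * (u - 1)"
    by (simp add: u_def l_def affine_dn_def field_simps)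
  have "0 < l * u + (1 - l)"
    using l u by (intro add_pos_pos) auto
  then have pos: "0 < 1 + l * (u - 1)" by (simp add: algebra_simps)
  then show aff_pos: "0 < affine_dn y"
    unfolding aff[symmetric] by (simp add: zero_less_divide_iff)
  have "u powr (2 - fib_exponent) \<le> 1 + (2 - fib_exponent) * (u - 1)"
    using u fib_exponent_lower fib_exponent_upper by (intro powr_le_affine) auto
  also have "\<dots> \<le> 1 + l * (u - 1)"
  proof (intro add_left_mono)
    show "(2 - fib_exponent) * (u - 1) \<le> l * (u - 1)"
    proof (cases "1 \<le> u")
      case True
      then have "2 - fib_exponent \<le> l" using iff fib_exponent_lower by (simp add: l_def)
      with True show ?thesis by (intro mult_right_mono) auto
    next
      case False
      then have "l \<le> 2 - fib_exponent" using iff fib_exponent_upper by (simp add: l_def)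
      with False show ?thesis by (intro mult_right_mono_neg) auto
    qed
  qed
  finally have le: "u powr (2 - fib_exponent) \<le> 1 + l * (u - 1)" .
  have "real_of_int (y * y) / (2 ^ 26 * real_of_int (affine_dn y)) =
      u powr 2 / (real_of_int (affine_dn y) / 2 ^ 54)"
    using u aff_pos by (simp add: u_def power2_eq_square field_simps)
  also have "\<dots> \<le> u powr 2 / u powr (2 - fib_exponent)"
    unfolding aff using le pos u by (intro divide_left_mono) auto
  also have "\<dots> = u powr fib_exponent"
    by (subst powr_diff[symmetric]) simp
  finally show "real_of_int (y * y) / (2 ^ 26 * real_of_int (affine_dn y)) \<le> (real_of_int y / 2 ^ 40) powr fib_exponent"
    by (simp add: u_def)
qed

section \<open>The growth function relative to a base point\<close>

lemma powr_exponent_power: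
  assumes "0 < v"
  shows "(v powr fib_exponent) ^ k = (v ^ k) powr fib_exponent"
  using assms by (simp add: powr_powr powr_realpow[symmetric] mult.commute flip: powr_realpow)

lemma phi_power_powr: "(\<phi> ^ k) powr fib_exponent = 2 ^ k"
  using powr_exponent_power[of \<phi> k] by (simp add: phi_powr_exponent)

lemma sqrt5_power: "(sqrt 5 * w) ^ (2 * N) = (5 * w\<^sup>2) ^ N"
  by (simp add: power_mult power_mult_distrib)

text \<open>The hypotheses say that \<open>sqrt 5 * w\<close> is at least
  \<open>\<phi> powr (j / N)\<close>, whose power is \<open>2 powr (j / N)\<close>, and that
  \<open>W\<close> is at most the latter. The even exponent \<open>2 * N\<close> removes the square
  root.\<close>

lemma base_lower:
  assumes "0 < w" "0 < N" "0 \<le> W" "\<phi> ^ (2 * j) \<le> (5 * w\<^sup>2) ^ N" "W ^ N \<le> 2 ^ j"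
  shows "W \<le> (sqrt 5 * w) powr fib_exponent"
proof (rule power_le_imp_le_base)
  have "W ^ (2 * N) = (W ^ N) ^ 2" by (simp add: mult.commute flip: power_mult)
  also have "\<dots> \<le> (2 ^ j) ^ 2" using assms by (intro power_mono) auto
  also have "\<dots> = (\<phi> ^ (2 * j)) powr fib_exponent" 
    unfolding phi_power_powr by (simp add: mult.commute flip: power_mult)
  also have "\<dots> \<le> ((5 * w\<^sup>2) ^ N) powr fib_exponent"
    using assms fib_exponent_pos by (intro powr_mono2) auto
  also have "\<dots> = ((sqrt 5 * w) powr fib_exponent) ^ (2 * N)"
    using assms(1) by (simp add: powr_exponent_power sqrt5_power)
  finally show "W ^ Suc (2 * N - 1) \<le> ((sqrt 5 * w) powr fib_exponent) ^ Suc (2 * N - 1)"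
    using assms(2) by simp
qed simp

lemma base_upper:
  assumes "0 < w" "0 < N" "0 \<le> W" "(5 * w\<^sup>2) ^ N \<le> \<phi> ^ (2 * j)" "2 ^ j \<le> W ^ N"
  shows "(sqrt 5 * w) powr fib_exponent \<le> W"
proof (rule power_le_imp_le_base)
  have "((sqrt 5 * w) powr fib_exponent) ^ (2 * N) = ((5 * w\<^sup>2) ^ N) powr fib_exponent"
    using assms(1) by (simp add: powr_exponent_power sqrt5_power)
  also have "\<dots> \<le> (\<phi> ^ (2 * j)) powr fib_exponent"
    using assms fib_exponent_pos by (intro powr_mono2) auto
  also have "\<dots> = (2 ^ j) ^ 2"
    unfolding phi_power_powr by (simp add: mult.commute flip: power_mult)
  also have "\<dots> \<le> (W ^ N) ^ 2" using assms by (intro power_mono) auto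
  also have "\<dots> = W ^ (2 * N)" by (simp add: mult.commute flip: power_mult)
  finally show "((sqrt 5 * w) powr fib_exponent) ^ Suc (2 * N - 1) \<le> W ^ Suc (2 * N - 1)"
    using assms(2) by simp
qed (use assms in simp)

definition base_le :: "int \<Rightarrow> int \<Rightarrow> bool" where
  "base_le W w \<longleftrightarrow> 0 < w \<and> 0 < W \<and> real_of_int W / 2 ^ 36 \<le> (sqrt 5 * (real_of_int w / 2 ^ 36)) powr fib_exponent"

definition base_ge :: "int \<Rightarrow> int \<Rightarrow> bool" where
  "base_ge W w \<longleftrightarrow> 0 < w \<and> 0 < W \<and> (sqrt 5 * (real_of_int w / 2 ^ 36)) powr fib_exponent \<le> real_of_int W / 2 ^ 36"

text \<open>With \<open>1 / w\<close> a base point near \<open>x\<close>, the numerator has an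
  argument near 1, where the tangent bounds are sharp, and the denominator is one constant per base
  point.\<close>

lemma growth_eq_divide:
  assumes "0 < w"
  shows "growth x = (x * w) powr fib_exponent / (sqrt 5 * w) powr fib_exponent"
  using assms by (simp add: growth_def flip: powr_divide)

text \<open>The factor 16 converts the 36 fractional bits of \<open>w\<close> to the 40 of
  \<open>y\<close>; 58 is 94 - 36.\<close>

lemma growth_le_int:
  assumes "base_le W w" "0 < x" "16 * x * real_of_int w \<le> real_of_int y"
  shows "growth x * real_of_int W \<le> real_of_int (y * affine_up y) / 2 ^ 58"
proof -
  define v where "v = real_of_int w / 2 ^ 36"
  have v: "0 < v" and W: "0 < real_of_int W / 2 ^ 36" "real_of_int W / 2 ^ 36 \<le> (sqrt 5 * v) powr fib_exponent"
    using assms(1) by (auto simp: base_le_def v_def)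
  have xv: "0 < x * v" "x * v \<le> real_of_int y / 2 ^ 40"
    using assms v by (auto simp: v_def)
  then have "0 < real_of_int y" by (simp add: zero_less_divide_iff order.strict_trans2)
  then have y: "0 < y" by simp
  have "growth x \<le> (x * v) powr fib_exponent / (real_of_int W / 2 ^ 36)"
    unfolding growth_eq_divide[OF v] using W less_le_trans[OF W]
    by (intro divide_left_mono mult_pos_pos) auto
  also have "\<dots> \<le> (real_of_int y / 2 ^ 40) powr fib_exponent / (real_of_int W / 2 ^ 36)"
    using xv W fib_exponent_pos by (intro divide_right_mono powr_mono2) auto
  also have "\<dots> \<le> (real_of_int (y * affine_up y) / 2 ^ 94) / (real_of_int W / 2 ^ 36)"
    using W powr_exponent_le[OF y] by (intro divide_right_mono) auto
  also have "\<dots> = (real_of_int (y * affine_up y) / 2 ^ 58) / real_of_int W" by simp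
  finally show ?thesis
    using W by (simp add: pos_le_divide_eq zero_less_divide_iff)
qed

lemma growth_ge_int:
  assumes "base_ge W w" "0 < y" "real_of_int y \<le> 16 * x * real_of_int w"
  shows "real_of_int (y * y) * 2 ^ 10 \<le> growth x * real_of_int W * real_of_int (affine_dn y)"
proof -
  define v where "v = real_of_int w / 2 ^ 36"
  have v: "0 < v" and W: "0 < real_of_int W / 2 ^ 36" "(sqrt 5 * v) powr fib_exponent \<le> real_of_int W / 2 ^ 36"
    using assms(1) by (auto simp: base_ge_def v_def)
  have xv: "real_of_int y / 2 ^ 40 \<le> x * v"
    using assms by (auto simp: v_def)
  have "(real_of_int (y * y) / (2 ^ 26 * real_of_int (affine_dn y))) / (real_of_int W / 2 ^ 36)
      \<le> (real_of_int y / 2 ^ 40) powr fib_exponent / (real_of_int W / 2 ^ 36)"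
    using W powr_exponent_ge(2)[OF assms(2)] by (intro divide_right_mono) auto
  also have "\<dots> \<le> (x * v) powr fib_exponent / (real_of_int W / 2 ^ 36)"
    using xv assms(2) W fib_exponent_pos by (intro divide_right_mono powr_mono2) auto
  also have "\<dots> \<le> growth x"
    unfolding growth_eq_divide[OF v] using W v by (intro divide_left_mono) auto
  finally show ?thesis
    using W powr_exponent_ge(1)[OF assms(2)] by (simp add: zero_less_divide_iff field_simps)
qed

text \<open>Here \<open>a / b\<close> approximates \<open>\<phi> powr (j / N) / sqrt 5\<close> from
  above and \<open>c / d\<close> approximates \<open>2 powr (j / N)\<close> from below; the last two
  hypotheses round both to 36 bits.\<close>

lemma base_leI:
  fixes a b c d :: real
  assumes \<phi>: "\<phi> ^ (2 * j) * b ^ (2 * N) \<le> (5 * a\<^sup>2) ^ N"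
    and two: "c ^ N \<le> 2 ^ j * d ^ N"
    and pos: "0 < a" "0 < b" "0 < c" "0 < d" "0 < N" "0 < W"
    and W: "real_of_int W * d \<le> c * 2 ^ 36" and w: "a * 2 ^ 36 \<le> real_of_int w * b"
  shows "base_le W w"
proof -
  have ab: "a / b \<le> real_of_int w / 2 ^ 36"
    using w pos by (simp add: field_simps)
  have "0 < a / b" using pos by simp
  then have "0 < real_of_int w / 2 ^ 36" using ab by (rule less_le_trans)
  then have w0: "0 < real_of_int w" by (simp add: zero_less_divide_iff)
  have "real_of_int W / 2 ^ 36 \<le> c / d"
    using W pos by (simp add: field_simps)
  also have "\<dots> \<le> (sqrt 5 * (a / b)) powr fib_exponent"
  proof (rule base_lower[where N = N and j = j])
    show "\<phi> ^ (2 * j) \<le> (5 * (a / b)\<^sup>2) ^ N"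
      using \<phi> pos by (simp add: power_divide pos_le_divide_eq flip: power_mult)
    show "(c / d) ^ N \<le> 2 ^ j"
      using two pos by (simp add: power_divide pos_divide_le_eq)
  qed (use pos in auto)
  also have "\<dots> \<le> (sqrt 5 * (real_of_int w / 2 ^ 36)) powr fib_exponent"
    using ab pos fib_exponent_pos by (intro powr_mono2 mult_left_mono) auto
  finally show ?thesis using w0 pos by (simp add: base_le_def)
qed

lemma base_geI:
  fixes a b c d :: real
  assumes \<phi>: "(5 * a\<^sup>2) ^ N \<le> \<phi> ^ (2 * j) * b ^ (2 * N)"
    and two: "2 ^ j * d ^ N \<le> c ^ N"
    and pos: "0 < a" "0 < b" "0 < c" "0 < d" "0 < N" "0 < W" "0 < w"
    and W: "c * 2 ^ 36 \<le> real_of_int W * d" and w: "real_of_int w * b \<le> a * 2 ^ 36"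
  shows "base_ge W w"
proof -
  have "(sqrt 5 * (real_of_int w / 2 ^ 36)) powr fib_exponent \<le> (sqrt 5 * (a / b)) powr fib_exponent"
    using w pos fib_exponent_pos by (intro powr_mono2 mult_left_mono) (auto simp: field_simps)
  also have "\<dots> \<le> c / d"
  proof (rule base_upper[where N = N and j = j])
    show "(5 * (a / b)\<^sup>2) ^ N \<le> \<phi> ^ (2 * j)"
      using \<phi> pos by (simp add: power_divide pos_divide_le_eq flip: power_mult)
    show "2 ^ j \<le> (c / d) ^ N"
      using two pos by (simp add: power_divide pos_le_divide_eq)
  qed (use pos in auto)
  also have "\<dots> \<le> real_of_int W / 2 ^ 36"
    using W pos by (simp add: field_simps)
  finally show ?thesis using pos by (simp add: base_ge_def)
qed

text \<open>The base points \<open>2\<^sup>3\<^sup>6 / w\<close> lie close to \<open>1.0377\<close> and \<open>1.3594\<close>, where the quotient attains its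
  minimum and maximum.  The fractions are one-sided approximations from continued fractions, such as
  \<open>1444 / 1499\<close> for \<open>\<phi>\<^sup>5\<^sup>9\<^sup>/\<^sup>3\<^sup>7 / \<surd>5\<close> and \<open>29455 / 9753\<close> for \<open>2\<^sup>5\<^sup>9\<^sup>/\<^sup>3\<^sup>7\<close>.\<close>

lemma phi_power_118: "\<phi> ^ 118 \<le> 4576585175559979521848109"
  using phi_upper by (simp add: phi_powers)

lemma base_le_min: "base_le 207539442967 66198081659"
proof -
  have "\<phi> ^ (2 * 59) * 1499 ^ (2 * 37) \<le> 4576585175559979521848109 * 1499 ^ (2 * 37)"
    using phi_power_118 by (intro mult_right_mono) auto
  also have "\<dots> \<le> (5 * 1444\<^sup>2) ^ 37" by simp
  finally show ?thesis
    by (rule base_leI[where c = 29455 and d = 9753]) simp_all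
qed

lemma phi_power_134: "10100521408792493581009983104 \<le> \<phi> ^ 134"
  using phi_lower by (simp add: phi_powers)

lemma base_ge_min: "base_ge 207632035534 66218583554"
proof -
  have "(5 * 12021\<^sup>2) ^ 42 \<le> 10100521408792493581009983104 * (12475 :: real) ^ (2 * 42)" by simp
  also have "\<dots> \<le> \<phi> ^ (2 * 67) * 12475 ^ (2 * 42)"
    using phi_power_134 by (intro mult_right_mono) auto
  finally show ?thesis
    by (rule base_geI[where c = 59601 and d = 19726]) simp_all
qed

lemma phi_power_62: "\<phi> ^ 62 \<le> 9062201101804"
  using phi_upper by (simp add: phi_powers)

lemma base_le_max: "base_le 140651436557 50529934758"
proof -
  have "\<phi> ^ (2 * 31) * 31172 ^ (2 * 30) \<le> 9062201101804 * 31172 ^ (2 * 30)"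
    using phi_power_62 by (intro mult_right_mono) auto
  also have "\<dots> \<le> (5 * 22921\<^sup>2) ^ 30" by simp
  finally show ?thesis
    by (rule base_leI[where c = 22373 and d = 10931]) simp_all
qed

lemma phi_power_60: "3461452808001 \<le> \<phi> ^ 60"
  using phi_lower by (simp add: phi_powers)

lemma base_ge_max: "base_ge 140763541478 50557891255"
proof -
  have "(5 * 38071\<^sup>2) ^ 29 \<le> 3461452808001 * (51747 :: real) ^ (2 * 29)" by simp
  also have "\<dots> \<le> \<phi> ^ (2 * 30) * 51747 ^ (2 * 29)"
    using phi_power_60 by (intro mult_right_mono) auto
  finally show ?thesis
    by (rule base_geI[where c = 29003 and d = 14159]) simp_all
qed

section \<open>Branch and bound over cylinders\<close>

text \<open>The factor \<open>2 - \<phi>\<close> is the inverse square of \<open>\<phi>\<close>, so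
  \<open>G_scale\<close> applies twice.\<close>

lemma G_inverse_square:
  assumes "0 \<le> t" "t \<le> \<phi>"
  shows "G ((2 - \<phi>) * t) = G t / 4"
proof -
  have "\<phi> * (\<phi> * (2 - \<phi>)) = 1"
    using phi_mult_self by (simp add: algebra_simps)
  then have t: "\<phi> * (\<phi> * ((2 - \<phi>) * t)) = t"
    by (metis mult.assoc mult_1)
  have 0: "0 \<le> (2 - \<phi>) * t" using assms phi_bounds by auto
  have "\<phi> * ((2 - \<phi>) * t) \<le> \<phi> * (\<phi> * ((2 - \<phi>) * t))"
    using 0 mult_right_mono[of 1 \<phi> "\<phi> * ((2 - \<phi>) * t)"] by simp
  then have "\<phi> * ((2 - \<phi>) * t) \<le> \<phi>"
    unfolding t using assms(2) by (rule order_trans)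
  then have "G (\<phi> * ((2 - \<phi>) * t)) = 2 * G ((2 - \<phi>) * t)"
    using 0 by (intro G_scale)
  moreover have "G (\<phi> * (\<phi> * ((2 - \<phi>) * t))) = 2 * G (\<phi> * ((2 - \<phi>) * t))"
    using 0 assms(2) by (intro G_scale) (simp_all only: t, simp)
  ultimately show ?thesis unfolding t by simp
qed

text \<open>The factor \<open>2 * \<phi> - 3\<close> is the inverse cube of
  \<open>\<phi>\<close>.\<close>

lemma G_inverse_cube:
  assumes "0 \<le> t" "t \<le> \<phi>"
  shows "G ((2 * \<phi> - 3) * t) = G t / 8"
proof -
  have eq: "\<phi> * ((2 * \<phi> - 3) * t) = (2 - \<phi>) * t"
    using phi_mult_self by (simp add: algebra_simps flip: mult.assoc)
  have "(2 - \<phi>) * t \<le> 1 * \<phi>"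
    using assms phi_bounds by (intro mult_mono) auto
  then have "G (\<phi> * ((2 * \<phi> - 3) * t)) = 2 * G ((2 * \<phi> - 3) * t)"
    using assms phi_bounds by (intro G_scale) (auto simp: eq)
  then show ?thesis unfolding eq using G_inverse_square[OF assms] by simp
qed

lemma G_one_plus:
  "0 \<le> t \<Longrightarrow> t \<le> \<phi> - 1 \<Longrightarrow> G (1 + t) = 1 + G t - G (\<phi> - 1 - t)"
  using G_recurrence[of "1 + t"] by (simp add: algebra_simps)

text \<open>A state \<open>(a, b, r, s, n, c, p, q)\<close> describes the interval of all \<open>a + b \<phi> + (r + s \<phi>) t\<close> with
  \<open>0 \<le> t \<le> 1/\<phi>\<close>, on which \<open>n G = c + p G(t) + q G(1/\<phi> - t)\<close>.  It is split at \<open>t = \<phi>\<^sup>-\<^sup>3\<close> and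
  \<open>t = \<phi>\<^sup>-\<^sup>2\<close>, and each of the three pieces is again of this form.\<close>

type_synonym cylinder = "int \<times> int \<times> int \<times> int \<times> int \<times> int \<times> int \<times> int"

definition zphi :: "int \<Rightarrow> int \<Rightarrow> real" where
  "zphi a b = real_of_int a + real_of_int b * \<phi>"

fun point :: "cylinder \<Rightarrow> real \<Rightarrow> real" where
  "point (a, b, r, s, n, c, p, q) t = zphi a b + zphi r s * t"

fun is_cylinder :: "cylinder \<Rightarrow> bool" where
  "is_cylinder (a, b, r, s, n, c, p, q) \<longleftrightarrow> 0 < n \<and> 0 < zphi r s \<and>
    (\<forall>t. 0 \<le> t \<longrightarrow> t \<le> \<phi> - 1 \<longrightarrow>
      1 \<le> zphi a b + zphi r s * t \<and> zphi a b + zphi r s * t \<le> \<phi> \<and>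
      real_of_int n * G (zphi a b + zphi r s * t) =
        real_of_int c + real_of_int p * G t + real_of_int q * G (\<phi> - 1 - t))"

text \<open>The pair \<open>(r, s)\<close> is multiplied by an inverse square or cube of
  \<open>\<phi>\<close>. The other updates substitute \<open>G_child_map\<close> and multiply by 4
  or 8, so all entries stay integers.\<close>

fun child :: "nat \<Rightarrow> cylinder \<Rightarrow> cylinder" where
  "child k (a, b, r, s, n, c, p, q) =
    (if k = 0 then (a, b, 2*r - s, s - r, 4*n, 4*c + q, p - q, q)
     else if k = 1 then (a + (2*s - 3*r), b + (2*r - s), 2*s - 3*r, 2*r - s, 8*n, 8*c + p + q, p - q, q - p)
     else (a + (2*r - s), b + (s - r), 2*r - s, s - r, 4*n, 4*c + p, p, q - p))"

definition child_map :: "nat \<Rightarrow> real \<Rightarrow> real" where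
  "child_map k t = (if k = 0 then (2 - \<phi>) * t else if k = 1 then (2 * \<phi> - 3) * (1 + t) else (2 - \<phi>) * (1 + t))"

lemma zphi_inverse_square: "zphi (2*r - s) (s - r) = (2 - \<phi>) * zphi r s"
proof -
  have "(2 - \<phi>) * zphi r s = 2 * r + 2 * s * \<phi> - r * \<phi> - s * (\<phi> * \<phi>)"
    by (simp add: zphi_def algebra_simps)
  also have "\<dots> = zphi (2*r - s) (s - r)"
    unfolding phi_mult_self by (simp add: zphi_def algebra_simps)
  finally show ?thesis by simp
qed

lemma zphi_inverse_cube: "zphi (2*s - 3*r) (2*r - s) = (2 * \<phi> - 3) * zphi r s"
proof -
  have "(2 * \<phi> - 3) * zphi r s = 2 * r * \<phi> + 2 * s * (\<phi> * \<phi>) - 3 * r - 3 * s * \<phi>"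
    by (simp add: zphi_def algebra_simps)
  also have "\<dots> = zphi (2*s - 3*r) (2*r - s)"
    unfolding phi_mult_self by (simp add: zphi_def algebra_simps)
  finally show ?thesis by simp
qed

lemma zphi_add: "zphi (a + a') (b + b') = zphi a b + zphi a' b'"
  by (simp add: zphi_def algebra_simps)

lemma point_child: "point (child k C) t = point C (child_map k t)"
  by (cases C rule: is_cylinder.cases) (simp add: child_map_def zphi_add zphi_inverse_square zphi_inverse_cube, simp add: algebra_simps)

lemma child_map_range:
  assumes "0 \<le> t" "t \<le> \<phi> - 1"
  shows "0 \<le> child_map k t" "child_map k t \<le> \<phi> - 1"
proof -
  show "0 \<le> child_map k t"
    using assms phi_bounds by (auto simp: child_map_def)
  have "(2 - \<phi>) * (1 + t) \<le> (2 - \<phi>) * \<phi>" "(2 * \<phi> - 3) * (1 + t) \<le> (2 * \<phi> - 3) * \<phi>"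
    using assms phi_bounds by (auto intro!: mult_left_mono)
  moreover have "(2 - \<phi>) * \<phi> = \<phi> - 1" "(2 * \<phi> - 3) * \<phi> = 2 - \<phi>"
    using phi_mult_self by (auto simp: algebra_simps)
  moreover have "(2 - \<phi>) * t \<le> 1 * t"
    using assms phi_bounds by (intro mult_right_mono) auto
  ultimately show "child_map k t \<le> \<phi> - 1"
    using assms phi_bounds by (auto simp: child_map_def)
qed

lemma child_map_cover:
  assumes "0 \<le> t" "t \<le> \<phi> - 1"
  obtains k u where "k \<in> {0, 1, 2}" "0 \<le> u" "u \<le> \<phi> - 1" "t = child_map k u"
proof -
  have sq: "(2 - \<phi>) * (\<phi> + 1) = 1" and cu: "(2 * \<phi> - 3) * (2 * \<phi> + 1) = 1"
    using phi_mult_self by (auto simp: algebra_simps)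
  consider "t \<le> 2 * \<phi> - 3" | "2 * \<phi> - 3 \<le> t" "t \<le> 2 - \<phi>" | "2 - \<phi> \<le> t" by linarith
  then show ?thesis
  proof cases
    case 1
    have "(\<phi> + 1) * t \<le> (\<phi> + 1) * (2 * \<phi> - 3)" using 1 by (intro mult_left_mono) auto
    also have "\<dots> = \<phi> - 1" using phi_mult_self by (auto simp: algebra_simps)
    finally have "(\<phi> + 1) * t \<le> \<phi> - 1" .
    moreover have "t = child_map 0 ((\<phi> + 1) * t)"
      by (simp add: child_map_def sq flip: mult.assoc)
    ultimately show ?thesis using assms that[of 0 "(\<phi> + 1) * t"] by auto
  next
    case 2
    have "(2 * \<phi> + 1) * (2 * \<phi> - 3) \<le> (2 * \<phi> + 1) * t" "(2 * \<phi> + 1) * t \<le> (2 * \<phi> + 1) * (2 - \<phi>)"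
      using 2 by (auto intro!: mult_left_mono)
    moreover have "(2 * \<phi> + 1) * (2 - \<phi>) = \<phi>" using phi_mult_self by (auto simp: algebra_simps)
    moreover have "t = child_map 1 ((2 * \<phi> + 1) * t - 1)"
      by (simp add: child_map_def cu flip: mult.assoc)
    ultimately show ?thesis using cu that[of 1 "(2 * \<phi> + 1) * t - 1"] by (auto simp: mult.commute)
  next
    case 3
    have "(\<phi> + 1) * (2 - \<phi>) \<le> (\<phi> + 1) * t" "(\<phi> + 1) * t \<le> (\<phi> + 1) * (\<phi> - 1)"
      using 3 assms by (auto intro!: mult_left_mono)
    moreover have "(\<phi> + 1) * (\<phi> - 1) = \<phi>" using phi_mult_self by (auto simp: algebra_simps)
    moreover have "t = child_map 2 ((\<phi> + 1) * t - 1)"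
      by (simp add: child_map_def sq flip: mult.assoc)
    ultimately show ?thesis using sq that[of 2 "(\<phi> + 1) * t - 1"] by (auto simp: mult.commute)
  qed
qed

text \<open>Reflecting \<open>t\<close> to \<open>\<phi> - 1 - t\<close> swaps the outer pieces and
  fixes the middle one. Scaling and \<open>G_one_plus\<close> therefore express everything by 1,
  \<open>G t\<close> and \<open>G (\<phi> - 1 - t)\<close>, which keeps the form of a
  cylinder.\<close>

lemma G_child_map:
  assumes "0 \<le> t" "t \<le> \<phi> - 1"
  shows "G (child_map 0 t) = G t / 4"
    "G (\<phi> - 1 - child_map 0 t) = (1 + G (\<phi> - 1 - t) - G t) / 4"
    "G (child_map (Suc 0) t) = (1 + G t - G (\<phi> - 1 - t)) / 8"
    "G (\<phi> - 1 - child_map (Suc 0) t) = (1 + G (\<phi> - 1 - t) - G t) / 8"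
    "G (child_map 2 t) = (1 + G t - G (\<phi> - 1 - t)) / 4"
    "G (\<phi> - 1 - child_map 2 t) = G (\<phi> - 1 - t) / 4"
proof -
  have eq: "\<phi> - 1 - child_map 0 t = (2 - \<phi>) * (1 + (\<phi> - 1 - t))"
    "\<phi> - 1 - child_map 1 t = (2 * \<phi> - 3) * (1 + (\<phi> - 1 - t))"
    "\<phi> - 1 - child_map 2 t = (2 - \<phi>) * (\<phi> - 1 - t)"
    using phi_mult_self by (simp_all add: child_map_def algebra_simps)
  have G1: "G (1 + t) = 1 + G t - G (\<phi> - 1 - t)" "G (1 + (\<phi> - 1 - t)) = 1 + G (\<phi> - 1 - t) - G t"
    using G_one_plus[of t] G_one_plus[of "\<phi> - 1 - t"] assms by simp_all
  show "G (child_map 0 t) = G t / 4"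
    using assms G_inverse_square[of t] by (simp add: child_map_def)
  show "G (\<phi> - 1 - child_map 0 t) = (1 + G (\<phi> - 1 - t) - G t) / 4"
    unfolding eq G1(2)[symmetric] using assms by (intro G_inverse_square) auto
  show "G (child_map (Suc 0) t) = (1 + G t - G (\<phi> - 1 - t)) / 8"
    using assms G_inverse_cube[of "1 + t"] G1 by (simp add: child_map_def)
  show "G (\<phi> - 1 - child_map (Suc 0) t) = (1 + G (\<phi> - 1 - t) - G t) / 8"
    unfolding eq[unfolded One_nat_def] G1(2)[symmetric] using assms by (intro G_inverse_cube) auto
  show "G (child_map 2 t) = (1 + G t - G (\<phi> - 1 - t)) / 4"
    using assms G_inverse_square[of "1 + t"] G1 by (simp add: child_map_def)
  show "G (\<phi> - 1 - child_map 2 t) = G (\<phi> - 1 - t) / 4"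
    unfolding eq using assms by (intro G_inverse_square) auto
qed

lemma is_cylinder_child:
  assumes "is_cylinder C" "k \<in> {0, 1, 2}"
  shows "is_cylinder (child k C)"
proof -
  obtain a b r s n c p q where C: "C = (a, b, r, s, n, c, p, q)" by (cases C rule: is_cylinder.cases)
  obtain a' b' r' s' n' c' p' q' where C': "child k C = (a', b', r', s', n', c', p', q')"
    by (cases "child k C" rule: is_cylinder.cases)
  define f :: real where "f = (if k = 1 then 8 else 4)"
  have n: "0 < n" and rs: "0 < zphi r s" using assms(1) C by auto
  consider "k = 0" | "k = Suc 0" | "k = 2" using assms(2) by auto
  then have scale: "real_of_int n' = f * real_of_int n \<and> 0 < zphi r' s' \<and>
      (\<forall>t. 0 \<le> t \<longrightarrow> t \<le> \<phi> - 1 \<longrightarrow>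
        f * (real_of_int c + real_of_int p * G (child_map k t) + real_of_int q * G (\<phi> - 1 - child_map k t)) =
        real_of_int c' + real_of_int p' * G t + real_of_int q' * G (\<phi> - 1 - t))"
  proof cases
    case 1
    then have "r' = 2*r - s" "s' = s - r" "n' = 4*n" "c' = 4*c + q" "p' = p - q" "q' = q"
      using C C' by simp_all
    then show ?thesis
      using 1 rs phi_bounds by (simp add: zphi_inverse_square f_def G_child_map) (simp add: algebra_simps)
  next
    case 2
    then have "r' = 2*s - 3*r" "s' = 2*r - s" "n' = 8*n" "c' = 8*c + p + q" "p' = p - q" "q' = q - p"
      using C C' by simp_all
    then show ?thesis
      using 2 rs phi_bounds by (simp add: zphi_inverse_cube f_def G_child_map) (simp add: algebra_simps)
  next
    case 3
    then have "r' = 2*r - s" "s' = s - r" "n' = 4*n" "c' = 4*c + p" "p' = p" "q' = q - p"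
      using C C' by simp_all
    then show ?thesis
      using 3 rs phi_bounds by (simp add: zphi_inverse_square f_def G_child_map) (simp add: algebra_simps)
  qed
  have "1 \<le> point (child k C) t \<and> point (child k C) t \<le> \<phi> \<and>
      real_of_int n' * G (point (child k C) t) =
        real_of_int c' + real_of_int p' * G t + real_of_int q' * G (\<phi> - 1 - t)"
    if t: "0 \<le> t" "t \<le> \<phi> - 1" for t
  proof -
    have "1 \<le> point C (child_map k t)" "point C (child_map k t) \<le> \<phi>" and
      eq: "real_of_int n * G (point C (child_map k t)) =
        real_of_int c + real_of_int p * G (child_map k t) + real_of_int q * G (\<phi> - 1 - child_map k t)"
      using assms(1) child_map_range[OF t, of k] unfolding C by auto
    moreover have "real_of_int n' * G (point C (child_map k t)) = f * (real_of_int n * G (point C (child_map k t)))"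
      using scale by simp
    ultimately show ?thesis
      using scale t unfolding point_child eq by metis
  qed
  moreover have "0 < n'"
  proof -
    have "0 < real_of_int n'" using scale n by (simp add: f_def)
    then show ?thesis by simp
  qed
  ultimately show ?thesis
    using scale unfolding C' by simp
qed

text \<open>Exhausting the depth counts as failure, so success means that accepted cylinders cover
  the whole interval.\<close>

fun check :: "(cylinder \<Rightarrow> bool) \<Rightarrow> nat \<Rightarrow> cylinder \<Rightarrow> bool" where
  "check ok 0 C = False"
| "check ok (Suc d) C =
    (if ok C then True
     else if check ok d (child 0 C) then
       if check ok d (child 1 C) then check ok d (child 2 C) else False
     else False)"

lemma check_sound:
  assumes ok: "\<And>C t. ok C \<Longrightarrow> is_cylinder C \<Longrightarrow> 0 \<le> t \<Longrightarrow> t \<le> \<phi> - 1 \<Longrightarrow> P (point C t)"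
    and "check ok d C" "is_cylinder C" "0 \<le> t" "t \<le> \<phi> - 1"
  shows "P (point C t)"
  using assms(2-)
proof (induction d arbitrary: C t)
  case (Suc d)
  show ?case
  proof (cases "ok C")
    case True
    then show ?thesis using ok Suc.prems by blast
  next
    case False
    obtain k u where k: "k \<in> {0, 1, 2}" and u: "0 \<le> u" "u \<le> \<phi> - 1" and t: "t = child_map k u"
      using child_map_cover Suc.prems by metis
    have "check ok d (child k C)"
      using Suc.prems(1) False k by (auto split: if_splits)
    then have "P (point (child k C) u)"
      using Suc.prems(2) k u by (intro Suc.IH is_cylinder_child) auto
    then show ?thesis by (simp add: point_child t)
  qed
qed simp

text \<open>All of \<open>[1, \<phi>]\<close>, with the coefficients of
  \<open>G_one_plus\<close>.\<close>

abbreviation root :: cylinder where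
  "root \<equiv> (1, 0, 1, 0, 1, 1, 1, -1)"

lemma is_cylinder_root: "is_cylinder root"
  by (auto simp: zphi_def G_one_plus)

lemma point_root: "point root t = 1 + t"
  by (simp add: zphi_def)

lemma G_endpoints:
  assumes "is_cylinder (a, b, r, s, n, c, p, q)"
  shows "G (zphi a b) = real_of_int (3 * c + q) / real_of_int (3 * n)"
    "G (zphi a b + zphi r s * (\<phi> - 1)) = real_of_int (3 * c + p) / real_of_int (3 * n)"
proof -
  have n: "0 < real_of_int n" using assms by simp
  have "real_of_int n * G (zphi a b) = real_of_int c + real_of_int q / 3"
    using assms[unfolded is_cylinder.simps, THEN conjunct2, THEN conjunct2, rule_format, of 0]
    by (simp add: G_0 G_phi_minus_1)
  then show "G (zphi a b) = real_of_int (3 * c + q) / real_of_int (3 * n)"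
    using n by (simp add: field_simps)
  have "real_of_int n * G (zphi a b + zphi r s * (\<phi> - 1)) = real_of_int c + real_of_int p / 3"
    using assms[unfolded is_cylinder.simps, THEN conjunct2, THEN conjunct2, rule_format, of "\<phi> - 1"]
    by (simp add: G_0 G_phi_minus_1)
  then show "G (zphi a b + zphi r s * (\<phi> - 1)) = real_of_int (3 * c + p) / real_of_int (3 * n)"
    using n by (simp add: field_simps)
qed

section \<open>Fixed-point tests on a cylinder\<close>

definition zphi_up :: "int \<Rightarrow> int \<Rightarrow> int" where
  "zphi_up a b = a * 2 ^ 52 + b * (if 0 \<le> b then 7286977268806824 else 7286977268806823)"

definition zphi_dn :: "int \<Rightarrow> int \<Rightarrow> int" where
  "zphi_dn a b = a * 2 ^ 52 + b * (if 0 \<le> b then 7286977268806823 else 7286977268806824)"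

text \<open>The sign of \<open>b\<close> decides which end of the enclosure of \<open>\<phi>\<close>
  gives an upper bound.\<close>

lemma zphi_up: "zphi a b * 2 ^ 52 \<le> real_of_int (zphi_up a b)"
proof -
  have phi: "\<phi> * 2 ^ 52 \<le> 7286977268806824" "7286977268806823 \<le> \<phi> * 2 ^ 52"
    using phi_lower phi_upper by simp_all
  show ?thesis
  proof (cases "0 \<le> b")
    case True
    then have "real_of_int b * (\<phi> * 2 ^ 52) \<le> real_of_int b * 7286977268806824"
      by (intro mult_left_mono phi) simp
    with True show ?thesis by (simp add: zphi_def zphi_up_def algebra_simps)
  next
    case False
    then have "real_of_int b * (\<phi> * 2 ^ 52) \<le> real_of_int b * 7286977268806823"
      by (intro mult_left_mono_neg phi) simp
    with False show ?thesis by (simp add: zphi_def zphi_up_def algebra_simps)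
  qed
qed

lemma zphi_dn: "real_of_int (zphi_dn a b) \<le> zphi a b * 2 ^ 52"
proof -
  have "zphi (- a) (- b) * 2 ^ 52 \<le> real_of_int (zphi_up (- a) (- b))" by (rule zphi_up)
  moreover have "zphi (- a) (- b) = - zphi a b" by (simp add: zphi_def)
  moreover have "zphi_up (- a) (- b) = - zphi_dn a b" by (auto simp: zphi_up_def zphi_dn_def)
  ultimately show ?thesis by simp
qed

text \<open>A product of a 36-bit and a 52-bit fixed-point number has 88 fractional bits; dropping
  48 leaves the 40 expected by \<open>affine_up\<close>.\<close>

definition round_up :: "int \<Rightarrow> int" where
  "round_up y = y div 2 ^ 48 + 1"

definition round_dn :: "int \<Rightarrow> int" where
  "round_dn y = y div 2 ^ 48"

lemma round_up: "real_of_int y / 2 ^ 48 \<le> real_of_int (round_up y)"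
  unfolding round_up_def
  using real_of_int_div4 floor_divide_of_int_eq[of y "2 ^ 48", where 'a = real] by simp

lemma round_dn: "real_of_int (round_dn y) \<le> real_of_int y / 2 ^ 48"
  unfolding round_dn_def using real_of_int_div4[of y "2 ^ 48"] by simp

lemma growth_le_zphi:
  assumes "base_le W w" "0 < zphi a b" "y = round_up (w * zphi_up a b)"
  shows "growth (zphi a b) * real_of_int W \<le> real_of_int (y * affine_up y) / 2 ^ 58"
proof (rule growth_le_int[OF assms(1,2)])
  have w: "0 < w" using assms(1) by (simp add: base_le_def)
  have "16 * zphi a b * real_of_int w = real_of_int w * (zphi a b * 2 ^ 52) / 2 ^ 48" by simp
  also have "\<dots> \<le> real_of_int w * real_of_int (zphi_up a b) / 2 ^ 48"
    using w zphi_up[of a b] by (intro divide_right_mono mult_left_mono) auto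
  also have "\<dots> \<le> real_of_int y"
    using round_up[of "w * zphi_up a b"] assms(3) by simp
  finally show "16 * zphi a b * real_of_int w \<le> real_of_int y" .
qed

lemma growth_ge_zphi:
  assumes "base_ge W w" "y = round_dn (w * zphi_dn a b)" "0 < y"
  shows "real_of_int (y * y) * 2 ^ 10 \<le> growth (zphi a b) * real_of_int W * real_of_int (affine_dn y)"
proof (rule growth_ge_int[OF assms(1,3)])
  have w: "0 < w" using assms(1) by (simp add: base_ge_def)
  have "real_of_int y \<le> real_of_int w * real_of_int (zphi_dn a b) / 2 ^ 48"
    using round_dn[of "w * zphi_dn a b"] assms(2) by simp
  also have "\<dots> \<le> real_of_int w * (zphi a b * 2 ^ 52) / 2 ^ 48"
    using w zphi_dn[of a b] by (intro divide_right_mono mult_left_mono) auto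
  also have "\<dots> = 16 * zphi a b * real_of_int w" by simp
  finally show "real_of_int y \<le> 16 * zphi a b * real_of_int w" .
qed

text \<open>\<open>8813862 / 2\<^sup>2\<^sup>4\<close> and \<open>9116557 / 2\<^sup>2\<^sup>4\<close> lie just inside the windows for the limit inferior
  and the limit superior.\<close>

definition test_lower :: "int \<Rightarrow> int \<Rightarrow> int \<Rightarrow> int \<Rightarrow> bool" where
  "test_lower W g n y \<longleftrightarrow> 3 * n * 8813862 * (y * affine_up y) \<le> g * W * 2 ^ 80"

text \<open>Compares \<open>G\<close> at the left endpoint with \<open>growth\<close> at the right
  one, whose coordinates are explained by \<open>zphi_right\<close>. Two base points are tried since
  each gives sharp bounds only nearby.\<close>

fun ok_lower :: "cylinder \<Rightarrow> bool" where
  "ok_lower (a, b, r, s, n, c, p, q) \<longleftrightarrow>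
    (if test_lower 207539442967 (3 * c + q) n (round_up (66198081659 * zphi_up (a + (s - r)) (b + r))) then True
     else test_lower 140651436557 (3 * c + q) n (round_up (50529934758 * zphi_up (a + (s - r)) (b + r))))"

definition test_upper :: "int \<Rightarrow> int \<Rightarrow> int \<Rightarrow> int \<Rightarrow> bool" where
  "test_upper W g n y \<longleftrightarrow> (if 0 < y then g * W * 2 ^ 12 * affine_dn y \<le> 3 * n * 9116557 * (y * y) else False)"

fun ok_upper :: "cylinder \<Rightarrow> bool" where
  "ok_upper (a, b, r, s, n, c, p, q) \<longleftrightarrow>
    test_upper 140763541478 (3 * c + p) n (round_dn (50557891255 * zphi_dn a b))"

lemma zphi_right: "zphi (a + (s - r)) (b + r) = zphi a b + zphi r s * (\<phi> - 1)"
proof -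
  have "zphi r s * (\<phi> - 1) = r * \<phi> - r + s * (\<phi> * \<phi>) - s * \<phi>"
    by (simp add: zphi_def algebra_simps)
  also have "\<dots> = zphi (s - r) r"
    unfolding phi_mult_self by (simp add: zphi_def algebra_simps)
  finally show ?thesis by (simp add: zphi_add)
qed

lemma ok_lower_sound:
  assumes "ok_lower C" "is_cylinder C" "0 \<le> t" "t \<le> \<phi> - 1"
  shows "4 * (8813862 / 2 ^ 24) * growth (point C t) \<le> G (point C t)"
proof -
  obtain a b r s n c p q where C: "C = (a, b, r, s, n, c, p, q)" by (cases C rule: is_cylinder.cases)
  let ?x = "zphi (a + (s - r)) (b + r)"
  note cyl = assms(2)[unfolded C]
  have range: "1 \<le> zphi a b + zphi r s * u" "zphi a b + zphi r s * u \<le> \<phi>" if "0 \<le> u" "u \<le> \<phi> - 1" for u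
    using cyl that by auto
  have rs: "0 < zphi r s" and n: "0 < n" using cyl by auto
  have x: "1 \<le> ?x" using range[of "\<phi> - 1"] by (simp add: zphi_right)
  obtain W w where W: "base_le W w"
    and test: "test_lower W (3 * c + q) n (round_up (w * zphi_up (a + (s - r)) (b + r)))"
    using assms(1) base_le_min base_le_max unfolding C by (auto split: if_splits)
  define y where "y = round_up (w * zphi_up (a + (s - r)) (b + r))"
  have W0: "0 < real_of_int W" using W by (simp add: base_le_def)
  have "real_of_int (3 * n * 8813862 * (y * affine_up y)) \<le> real_of_int ((3 * c + q) * W * 2 ^ 80)"
    using test unfolding test_lower_def y_def[symmetric] of_int_le_iff .
  then have test': "3 * real_of_int n * 8813862 * real_of_int (y * affine_up y) \<le> real_of_int (3 * c + q) * real_of_int W * 2 ^ 80"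
    by simp
  have growth: "growth ?x * real_of_int W * 2 ^ 58 \<le> real_of_int (y * affine_up y)"
    using growth_le_zphi[OF W _ y_def] x by (subst pos_le_divide_eq[symmetric]) auto
  have "(3 * real_of_int n * 8813862 * growth ?x) * (real_of_int W * 2 ^ 58)
      = 3 * real_of_int n * 8813862 * (growth ?x * real_of_int W * 2 ^ 58)"
    by (simp only: mult_ac)
  also have "\<dots> \<le> 3 * real_of_int n * 8813862 * real_of_int (y * affine_up y)"
    using growth n by (intro mult_left_mono) auto
  also have "\<dots> \<le> real_of_int (3 * c + q) * real_of_int W * 2 ^ 80" by (rule test')
  \<comment> \<open>The exponent 58 comes from the growth bound and 22 from the constant
    \<open>4 / 2 ^ 24\<close>.\<close>
  also have "(2::real) ^ 80 = 2 ^ 22 * 2 ^ 58" by simp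
  also have "real_of_int (3 * c + q) * real_of_int W * (2 ^ 22 * 2 ^ 58) =
      (real_of_int (3 * c + q) * 2 ^ 22) * (real_of_int W * 2 ^ 58)"
    by (simp only: mult_ac)
  finally have "(3 * real_of_int n * 8813862 * growth ?x) * (real_of_int W * 2 ^ 58) \<le>
      (real_of_int (3 * c + q) * 2 ^ 22) * (real_of_int W * 2 ^ 58)" .
  then have "3 * real_of_int n * 8813862 * growth ?x \<le> real_of_int (3 * c + q) * 2 ^ 22"
    using W0 by (elim mult_right_le_imp_le) simp
  then have bound: "4 * (8813862 / 2 ^ 24) * growth ?x \<le> real_of_int (3 * c + q) / real_of_int (3 * n)"
    using n by (simp add: field_simps)
  have "growth (point C t) \<le> growth ?x"
    unfolding zphi_right using range[of t] assms rs by (intro growth_mono) (auto simp: C intro!: mult_left_mono)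
  then have "4 * (8813862 / 2 ^ 24) * growth (point C t) \<le> 4 * (8813862 / 2 ^ 24) * growth ?x" by simp
  also note bound
  also have "real_of_int (3 * c + q) / real_of_int (3 * n) = G (zphi a b)"
    using G_endpoints(1)[OF cyl] by simp
  also have "G (zphi a b) \<le> G (point C t)"
    using range[of 0] range[of t] assms rs by (intro G_mono) (auto simp: C)
  finally show ?thesis .
qed

lemma ok_upper_sound:
  assumes "ok_upper C" "is_cylinder C" "0 \<le> t" "t \<le> \<phi> - 1"
  shows "G (point C t) \<le> 4 * (9116557 / 2 ^ 24) * growth (point C t)"
proof -
  obtain a b r s n c p q where C: "C = (a, b, r, s, n, c, p, q)" by (cases C rule: is_cylinder.cases)
  note cyl = assms(2)[unfolded C]
  have range: "1 \<le> zphi a b + zphi r s * u" "zphi a b + zphi r s * u \<le> \<phi>" if "0 \<le> u" "u \<le> \<phi> - 1" for u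
    using cyl that by auto
  have rs: "0 < zphi r s" and n: "0 < n" using cyl by auto
  define W :: int where "W = 140763541478"
  define y where "y = round_dn (50557891255 * zphi_dn a b)"
  have W: "base_ge W 50557891255" unfolding W_def by (rule base_ge_max)
  have y: "0 < y" and test: "(3 * c + p) * W * 2 ^ 12 * affine_dn y \<le> 3 * n * 9116557 * (y * y)"
    using assms(1) unfolding C ok_upper.simps test_upper_def y_def[symmetric] W_def by (auto split: if_splits)
  have aff: "0 < real_of_int W * real_of_int (affine_dn y)"
    using W powr_exponent_ge(1)[OF y] by (simp add: base_ge_def)
  have "real_of_int ((3 * c + p) * W * 2 ^ 12 * affine_dn y) \<le> real_of_int (3 * n * 9116557 * (y * y))"
    using test unfolding of_int_le_iff .
  then have "real_of_int ((3 * c + p) * W * 2 ^ 12 * affine_dn y) * 2 ^ 10 \<le> real_of_int (3 * n * 9116557 * (y * y)) * 2 ^ 10"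
    by (rule mult_right_mono) simp
  then have "real_of_int (3 * c + p) * 2 ^ 22 * (real_of_int W * real_of_int (affine_dn y))
      \<le> 3 * real_of_int n * 9116557 * (real_of_int (y * y) * 2 ^ 10)"
    by (simp add: algebra_simps)
  also have "\<dots> \<le> 3 * real_of_int n * 9116557 * (growth (zphi a b) * real_of_int W * real_of_int (affine_dn y))"
    using growth_ge_zphi[OF W y_def y] n by (intro mult_left_mono) auto
  also have "\<dots> = (3 * real_of_int n * 9116557 * growth (zphi a b)) * (real_of_int W * real_of_int (affine_dn y))"
    by (simp add: mult_ac)
  finally have "real_of_int (3 * c + p) * 2 ^ 22 \<le> 3 * real_of_int n * 9116557 * growth (zphi a b)"
    using aff by (rule mult_right_le_imp_le)
  then have bound: "real_of_int (3 * c + p) / real_of_int (3 * n) \<le> 4 * (9116557 / 2 ^ 24) * growth (zphi a b)"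
    using n by (simp add: field_simps)
  have "G (point C t) \<le> G (zphi a b + zphi r s * (\<phi> - 1))"
    using range[of t] range[of "\<phi> - 1"] assms rs by (intro G_mono) (auto simp: C)
  also have "\<dots> = real_of_int (3 * c + p) / real_of_int (3 * n)"
    by (rule G_endpoints(2)[OF cyl])
  also note bound
  also have "4 * (9116557 / 2 ^ 24) * growth (zphi a b) \<le> 4 * (9116557 / 2 ^ 24) * growth (point C t)"
    using range[of 0] assms rs by (intro mult_left_mono growth_mono) (auto simp: C)
  finally show ?thesis .
qed

section \<open>Running the checks, and two explicit witnesses\<close>

lemma is_cylinder_foldr:
  "set ks \<subseteq> {0, 1, 2} \<Longrightarrow> is_cylinder C \<Longrightarrow> is_cylinder (foldr child ks C)"
  by (induction ks) (auto intro!: is_cylinder_child simp del: child.simps is_cylinder.simps)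

text \<open>The last level must accept, so this allows at most 13 successive splits.\<close>

lemma check_lower: "check ok_lower 14 root"
  by code_simp

lemma check_upper: "check ok_upper 13 root"
  by code_simp

lemma G_ge: 
  assumes "1 \<le> x" "x \<le> \<phi>"
  shows "4 * (8813862 / 2 ^ 24) * growth x \<le> G x"
proof -
  have "4 * (8813862 / 2 ^ 24) * growth (point root (x - 1)) \<le> G (point root (x - 1))"
    by (rule check_sound[where P = "\<lambda>x. 4 * (8813862 / 2 ^ 24) * growth x \<le> G x", OF ok_lower_sound check_lower is_cylinder_root]) (use assms in auto)
  then show ?thesis unfolding point_root by simp
qed

lemma G_le:
  assumes "1 \<le> x" "x \<le> \<phi>"
  shows "G x \<le> 4 * (9116557 / 2 ^ 24) * growth x"
proof -
  have "G (point root (x - 1)) \<le> 4 * (9116557 / 2 ^ 24) * growth (point root (x - 1))"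
    by (rule check_sound[where P = "\<lambda>x. G x \<le> 4 * (9116557 / 2 ^ 24) * growth x", OF ok_upper_sound check_upper is_cylinder_root]) (use assms in auto)
  then show ?thesis unfolding point_root by simp
qed

lemma left_endpoint:
  assumes "set ks \<subseteq> {0, 1, 2}" "foldr child ks root = (a, b, r, s, n, c, p, q)"
  shows "1 \<le> zphi a b" "zphi a b \<le> \<phi>" "G (zphi a b) = real_of_int (3 * c + q) / real_of_int (3 * n)"
proof -
  have cyl: "is_cylinder (a, b, r, s, n, c, p, q)"
    using is_cylinder_foldr[OF assms(1) is_cylinder_root] unfolding assms(2) .
  then show "G (zphi a b) = real_of_int (3 * c + q) / real_of_int (3 * n)"
    by (rule G_endpoints)
  show "1 \<le> zphi a b" "zphi a b \<le> \<phi>"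
    using cyl[unfolded is_cylinder.simps, THEN conjunct2, THEN conjunct2, rule_format, of 0] by simp_all
qed

text \<open>The paths lead to the cylinders that the branch and bound has to split most often.\<close>

lemma small_ratio:
  obtains x where "1 \<le> x" "x \<le> \<phi>" "G x / (4 * growth x) < 0.525349"
proof -
  let ?x = "zphi (-116999) 72310"
  \<comment> \<open>As \<open>foldr\<close> applies the last entry first, the path from the root
    reads from right to left.\<close>
  have "foldr child [1, 0, 0, 2, 0, 0, 1, 0, 1, 0, 0] root =
      (-116999, 72310, -121393, 75025, 33554432, 23335636, 180, -180)"
    by code_simp
  note x = left_endpoint[OF _ this]
  define y where "y = round_dn (66218583554 * zphi_dn (-116999) 72310)"
  \<comment> \<open>Close to \<open>2 ^ 40\<close>, so the witness is near the base point and little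
    is lost in the affine bound.\<close>
  have y: "y = 1099468468318" unfolding y_def by code_simp
  have "real_of_int (y * y) * 2 ^ 10 \<le> growth ?x * real_of_int 207632035534 * real_of_int (affine_dn y)"
    using y by (intro growth_ge_zphi[OF base_ge_min y_def]) simp
  moreover have "0 < growth ?x" using x by (intro growth_pos) auto
  ultimately have "G ?x / (4 * growth ?x) < 0.525349"
    using x(3) by (simp add: y affine_dn_def field_simps)
  with x show ?thesis by (intro that[of ?x]) auto
qed

lemma large_ratio:
  obtains x where "1 \<le> x" "x \<le> \<phi>" "0.5433878 < G x / (4 * growth x)"
proof -
  let ?x = "zphi 1998961 (-1235425)"
  have "foldr child [2, 2, 1, 2, 1, 2, 2, 0, 2, 2, 1, 2, 1] root =
      (1998961, -1235425, 1346269, -832040, 1073741824, 1139628198, 270, -810)"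
    by code_simp
  note x = left_endpoint[OF _ this]
  define y where "y = round_up (50529934758 * zphi_up 1998961 (-1235425))"
  have y: "y = 1099085634650" unfolding y_def by code_simp
  have "0 < ?x" using x by auto
  then have "growth ?x * real_of_int 140651436557 \<le> real_of_int (y * affine_up y) / 2 ^ 58"
    by (intro growth_le_zphi[OF base_le_max _ y_def])
  moreover have "0 < growth ?x" using x by (intro growth_pos) auto
  ultimately have "0.5433878 < G ?x / (4 * growth ?x)"
    using x(3) by (simp add: y affine_up_def field_simps)
  with x show ?thesis by (intro that[of ?x]) auto
qed

theorem theorem1p3:
  fixes c1 c2 :: ereal
  assumes "c1 = liminf (\<lambda>H::nat. ereal (real (A (int H)) / real H powr fib_exponent))"
    and "c2 = limsup (\<lambda>H::nat. ereal (real (A (int H)) / real H powr fib_exponent))"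
  shows "ereal 0.525347 < c1 \<and> c1 < ereal 0.525349 \<and>
         ereal 0.5433878 < c2 \<and> c2 < ereal 0.5433893 \<and>
         ereal 0.52534 \<le> c1 \<and> c1 < ereal 0.52535 \<and>
         ereal 0.54338 \<le> c2 \<and> c2 < ereal 0.54339"
proof -
  have "ereal (8813862 / 2 ^ 24) \<le> c1"
    unfolding assms(1) by (rule le_liminf_ratio) (simp, erule (1) G_ge)
  then have 1: "ereal 0.525347 < c1"
    by (rule less_le_trans[rotated]) simp
  obtain x where "1 \<le> x" "x \<le> \<phi>" "G x / (4 * growth x) < 0.525349"
    by (rule small_ratio)
  then have 2: "c1 < ereal 0.525349"
    unfolding assms(1) by (intro le_less_trans[OF liminf_ratio_le[of x]]) auto
  obtain x where "1 \<le> x" "x \<le> \<phi>" "0.5433878 < G x / (4 * growth x)"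
    by (rule large_ratio)
  then have 3: "ereal 0.5433878 < c2"
    unfolding assms(2) by (intro less_le_trans[OF _ le_limsup_ratio[of x]]) auto
  have "c2 \<le> ereal (9116557 / 2 ^ 24)"
    unfolding assms(2) by (rule limsup_ratio_le) (simp, erule (1) G_le)
  then have 4: "c2 < ereal 0.5433893"
    by (rule le_less_trans) simp
  have "ereal 0.52534 \<le> ereal 0.525347" "ereal 0.525349 < ereal 0.52535"
    "ereal 0.54338 \<le> ereal 0.5433878" "ereal 0.5433893 < ereal 0.54339"
    by simp_all
  with 1 2 3 4 show ?thesis
    by (meson less_imp_le less_trans order_trans)
qed

end
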